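(* A compact set $\emptyset\neq A\subset\mathbb{R}^2$ has positive reach if and only if, for each $a\in\partial A\setminus\operatorname{isol}A$, the set $A$ is of type $T^i$ at $a$ for some $i\in\{1,2,3\}$.
   Context: $\operatorname{isol}A$ is the set of isolated points of $A$. For nonempty $A\subset\mathbb{R}^d$, $\operatorname{Unp}A$ is the set of all $z\in\mathbb{R}^d$ for which there is exactly one $a\in A$ with $|z-a|=\operatorname{dist}(z,A)$. For $a\in A$, $\operatorname{reach}(A,a):=\sup\{r\ge 0: B(a,r)\subset\operatorname{Unp}A\}$, where $B(a,r)$ is the open ball and $B(a,0):=\emptyset$; $\operatorname{reach}A:=\inf_{a\in A}\operatorname{reach}(A,a)$. $A$ has positive reach if $\operatorname{reach}A>0$. A real function $u$ on an open interval $C\subset\mathbb{R}$ is semiconcave if it is continuous and there is $c\ge 0$ such that $x\mapsto u(x)-\frac c2|x|^2$ is concave on $C$; $v$ is semiconvex if $-v$ is semiconcave. For a real function $f$ with domain $\operatorname{Dom}(f)\subset \mathbb{R}$, $\operatorname{hypo}f:=\{(x,t)\in\operatorname{Dom}(f)\times\mathbb{R}: f(x)\ge t\}$ and $\operatorname{epi}f:=\{(x,t)\in\operatorname{Dom}(f)\times\mathbb{R}: f(x)\le t\}$. Let $M\subset\mathbb{R}^2$ and $r>0$. - $M$ is a $\tilde T^1_r$-set if there is a Lipschitz semiconcave function $\varphi$ on $(-r,r)$ such that $\varphi(0)=0$ and $M=B(0,r)\cap\operatorname{hypo}\varphi$. - $M$ is a $\tilde T^2_r$-set if there are Lipschitz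 functions $\psi\le\varphi$ on $(-r,r)$ such that $\varphi$ is semiconcave, $\psi$ is semiconvex, $\varphi(0)=\psi(0)=0$, $\varphi'(0)=\psi'(0)=0$ and $M=B(0,r)\cap\operatorname{hypo}\varphi\cap\operatorname{epi}\psi$. - $M$ is a $\tilde T^3_r$-set if there are Lipschitz functions $\psi\le\varphi$ on $[0,r)$ such that $\varphi$ is semiconcave on $(0,r)$, $\psi$ is semiconvex on $(0,r)$, $\varphi(0)=\psi(0)=0$, the right derivatives satisfy $\varphi'_+(0)=\psi'_+(0)=0$, and $M=B(0,r)\cap\operatorname{hypo}\varphi\cap\operatorname{epi}\psi$. - $M$ is of type $T^i$ ($i=1,2,3$) at $x\in M$ if there exists an isometry $G:\mathbb{R}^2\to\mathbb{R}^2$ such that $G(x)=0$ and $G(M\cap B(x,r))$ is a $\tilde T^i_r$-set for some $r>0$. *)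

theory Defs
  imports "HOL-Analysis.Analysis"
begin

definition isolated_pts :: "'a::topological_space set \<Rightarrow> 'a set" where
  "isolated_pts A = {x. x isolated_in A}"

definition Unp :: "'a::metric_space set \<Rightarrow> 'a set" where
  "Unp A = {z. \<exists>!a. a \<in> A \<and> dist z a = infdist z A}"

text \<open>Values lie in the extended reals, since the supremum may be infinite. Note that
  \<^term>\<open>ball a 0 = {}\<close>, so \<open>r = 0\<close> always belongs to the set.\<close>

definition reach_at :: "'a::metric_space set \<Rightarrow> 'a \<Rightarrow> ereal" where
  "reach_at A a = (SUP r\<in>{r. 0 \<le> r \<and> ball a r \<subseteq> Unp A}. ereal r)"

definition reach :: "'a::metric_space set \<Rightarrow> ereal" where
  "reach A = (INF a\<in>A. reach_at A a)"

definition positive_reach :: "'a::metric_space set \<Rightarrow> bool" where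
  "positive_reach A \<longleftrightarrow> reach A > 0"

text \<open>A function with domain \<open>D \<subseteq> \<real>\<close> is represented by a total function together with \<open>D\<close>;
  its values outside \<open>D\<close> play no role. The plane is \<^typ>\<open>real \<times> real\<close>, whose metric is Euclidean.\<close>

definition semiconcave_on :: "real set \<Rightarrow> (real \<Rightarrow> real) \<Rightarrow> bool" where
  "semiconcave_on C u \<longleftrightarrow>
     continuous_on C u \<and> (\<exists>c\<ge>0. concave_on C (\<lambda>x. u x - c / 2 * \<bar>x\<bar>\<^sup>2))"

definition semiconvex_on :: "real set \<Rightarrow> (real \<Rightarrow> real) \<Rightarrow> bool" where
  "semiconvex_on C v \<longleftrightarrow> semiconcave_on C (\<lambda>x. - v x)"

definition is_lipschitz_on :: "real set \<Rightarrow> (real \<Rightarrow> real) \<Rightarrow> bool" where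
  "is_lipschitz_on D f \<longleftrightarrow> (\<exists>L. L-lipschitz_on D f)"

definition hypo :: "real set \<Rightarrow> (real \<Rightarrow> real) \<Rightarrow> (real \<times> real) set" where
  "hypo D f = {(x, t). x \<in> D \<and> f x \<ge> t}"

definition epi :: "real set \<Rightarrow> (real \<Rightarrow> real) \<Rightarrow> (real \<times> real) set" where
  "epi D f = {(x, t). x \<in> D \<and> f x \<le> t}"

definition T1_tilde :: "real \<Rightarrow> (real \<times> real) set \<Rightarrow> bool" where
  "T1_tilde r M \<longleftrightarrow>
     (\<exists>\<phi>. is_lipschitz_on {-r<..<r} \<phi> \<and> semiconcave_on {-r<..<r} \<phi> \<and> \<phi> 0 = 0 \<and>
          M = ball 0 r \<inter> hypo {-r<..<r} \<phi>)"

definition T2_tilde :: "real \<Rightarrow> (real \<times> real) set \<Rightarrow> bool" where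
  "T2_tilde r M \<longleftrightarrow>
     (\<exists>\<phi> \<psi>. is_lipschitz_on {-r<..<r} \<phi> \<and> is_lipschitz_on {-r<..<r} \<psi> \<and>
            (\<forall>x\<in>{-r<..<r}. \<psi> x \<le> \<phi> x) \<and>
            semiconcave_on {-r<..<r} \<phi> \<and> semiconvex_on {-r<..<r} \<psi> \<and>
            \<phi> 0 = 0 \<and> \<psi> 0 = 0 \<and>
            (\<phi> has_real_derivative 0) (at 0) \<and> (\<psi> has_real_derivative 0) (at 0) \<and>
            M = ball 0 r \<inter> hypo {-r<..<r} \<phi> \<inter> epi {-r<..<r} \<psi>)"

definition T3_tilde :: "real \<Rightarrow> (real \<times> real) set \<Rightarrow> bool" where
  "T3_tilde r M \<longleftrightarrow>
     (\<exists>\<phi> \<psi>. is_lipschitz_on {0..<r} \<phi> \<and> is_lipschitz_on {0..<r} \<psi> \<and>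
            (\<forall>x\<in>{0..<r}. \<psi> x \<le> \<phi> x) \<and>
            semiconcave_on {0<..<r} \<phi> \<and> semiconvex_on {0<..<r} \<psi> \<and>
            \<phi> 0 = 0 \<and> \<psi> 0 = 0 \<and>
            (\<phi> has_real_derivative 0) (at_right 0) \<and> (\<psi> has_real_derivative 0) (at_right 0) \<and>
            M = ball 0 r \<inter> hypo {0..<r} \<phi> \<inter> epi {0..<r} \<psi>)"

definition T_tilde :: "nat \<Rightarrow> real \<Rightarrow> (real \<times> real) set \<Rightarrow> bool" where
  "T_tilde i r M \<longleftrightarrow>
     i = 1 \<and> T1_tilde r M \<or> i = 2 \<and> T2_tilde r M \<or> i = 3 \<and> T3_tilde r M"

definition isometry :: "('a::metric_space \<Rightarrow> 'b::metric_space) \<Rightarrow> bool" where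
  "isometry G \<longleftrightarrow> (\<forall>x y. dist (G x) (G y) = dist x y)"

definition of_type_T :: "nat \<Rightarrow> (real \<times> real) set \<Rightarrow> real \<times> real \<Rightarrow> bool" where
  "of_type_T i M x \<longleftrightarrow>
     x \<in> M \<and> (\<exists>G :: real \<times> real \<Rightarrow> real \<times> real. isometry G \<and> G x = 0 \<and>
                (\<exists>r>0. T_tilde i r (G ` (M \<inter> ball x r))))"

end

theory Submission
  imports Defs
begin

text \<open>
  If \<open>A\<close> has positive reach, Brouwer's fixed point theorem shows that the nearest point \<open>w\<close> of \<open>z\<close>
  stays nearest when \<open>z\<close> moves away from \<open>w\<close> along the normal, up to a uniform distance. Hence every
  normal vector supports an exterior ball of fixed radius \<open>R\<close>, and the segment between two points
  \<open>p, q\<close> of \<open>A\<close> stays within distance \<open>O(|p - q|\<^sup>2)\<close> of \<open>A\<close>. At a non-isolated boundary point there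
  are either two linearly independent tangent directions, or the tangent directions are \<open>{u, -u}\<close> or \<open>{u}\<close>;
  these cases yield types 1, 2 and 3. In each of them the normals at nearby points make a definite
  angle with a fixed line, taken as the horizontal axis, so by the exterior balls every
  nearby point off \<open>A\<close> has the nearby part of \<open>A\<close> below an upward cone or above a downward cone. This makes
  the vertical sections of \<open>A\<close> intervals with Lipschitz end points, and the estimate for segments
  makes the end points semiconcave and semiconvex.

  Conversely, if \<open>A\<close> has one of the three types at a point, clamping the height of the midpoint of two points of
  \<open>A\<close> into the section above it shows that midpoints lie within \<open>O(|p - q|\<^sup>2)\<close> of \<open>A\<close>, which
  excludes two distinct nearest points for points close to \<open>A\<close>.
\<close>

section \<open>Nearest points and exterior balls\<close>

definition nearest :: "'a::metric_space set \<Rightarrow> 'a \<Rightarrow> 'a \<Rightarrow> bool" where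
  "nearest A z w \<longleftrightarrow> w \<in> A \<and> dist z w = infdist z A"

lemma nearest_le:
  assumes "nearest A z w" "q \<in> A"
  shows "dist z w \<le> dist z q"
  using assms infdist_le[of q A z] by (simp add: nearest_def)

lemma nearestI:
  assumes "w \<in> A" "\<And>q. q \<in> A \<Longrightarrow> dist z w \<le> dist z q"
  shows "nearest A z w"
proof -
  have "dist z w \<le> infdist z A"
    using assms by (auto simp: infdist_def intro!: cINF_greatest)
  moreover have "infdist z A \<le> dist z w"
    by (rule infdist_le[OF assms(1)])
  ultimately show ?thesis
    using assms(1) by (simp add: nearest_def)
qed

lemma nearest_exists:
  fixes A :: "'a::heine_borel set"
  assumes "closed A" "A \<noteq> {}"
  obtains w where "nearest A z w"
  using infdist_attains_inf[OF assms, of z] by (metis nearest_def)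

lemma Unp_iff: "z \<in> Unp A \<longleftrightarrow> (\<exists>!w. nearest A z w)"
  by (simp add: Unp_def nearest_def)

text \<open>A radius strictly below the infimum is exceeded by an admissible radius at every point
  of \<open>A\<close>, and smaller concentric balls are admissible too. The extended-real quantity
  is thus replaced by one real radius.\<close>

lemma positive_reach_iff_uniform:
  assumes "A \<noteq> {}"
  shows "positive_reach A \<longleftrightarrow> (\<exists>R>0. \<forall>a\<in>A. ball a R \<subseteq> Unp A)"
proof
  assume "positive_reach A"
  then obtain e where e: "0 < e" "e < reach A"
    unfolding positive_reach_def using dense by blast
  then obtain R where R: "0 < R" "ereal R < reach A"
    by (metis dense ereal_dense2 ereal_less(2) less_trans)
  have "ball a R \<subseteq> Unp A" if "a \<in> A" for a
  proof -
    have "ereal R < reach_at A a"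
      using R(2) that by (auto simp: reach_def intro: less_le_trans INF_lower)
    then obtain r where "ball a r \<subseteq> Unp A" "R < r"
      by (auto simp: reach_at_def less_SUP_iff)
    then show ?thesis
      using subset_ball[of R r a] by auto
  qed
  then show "\<exists>R>0. \<forall>a\<in>A. ball a R \<subseteq> Unp A"
    using R(1) by blast
next
  assume "\<exists>R>0. \<forall>a\<in>A. ball a R \<subseteq> Unp A"
  then obtain R where R: "R > 0" "\<And>a. a \<in> A \<Longrightarrow> ball a R \<subseteq> Unp A" by blast
  have "ereal R \<le> reach A"
    unfolding reach_def
  proof (rule INF_greatest)
    fix a assume "a \<in> A"
    then show "ereal R \<le> reach_at A a"
      unfolding reach_at_def using R by (intro SUP_upper) auto
  qed
  then show "positive_reach A"
    using R(1) less_le_trans[of 0 "ereal R"] by (simp add: positive_reach_def)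
qed

text \<open>Every point of the closed ball of radius \<open>\<epsilon>\<close> about
  \<open>x\<close> is closer than \<open>R\<close> to \<open>w\<close>, hence has a unique nearest
  point. Brouwer's theorem yields a point \<open>y\<close> of this ball lying exactly opposite to
  its own nearest point as seen from \<open>x\<close>; that \<open>y\<close> turns out to be the
  point of the conclusion.\<close>

lemma nearest_extend:
  fixes A :: "'a::euclidean_space set"
  assumes "compact A" and R: "\<And>a. a \<in> A \<Longrightarrow> ball a R \<subseteq> Unp A"
    and w: "nearest A x w" and "x \<notin> A" and "\<epsilon> > 0" and le: "dist x w + \<epsilon> < R"
  shows "nearest A (x + (\<epsilon> / dist x w) *\<^sub>R (x - w)) w"
proof -
  let ?C = "cball x \<epsilon>"
  have "w \<in> A" using w by (simp add: nearest_def)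
  have "?C \<subseteq> ball w R"
  proof
    fix y assume "y \<in> ?C"
    then show "y \<in> ball w R"
      using le dist_triangle[of w y x] by (simp add: dist_commute)
  qed
  then have uniq: "\<exists>!a. nearest A y a" if "y \<in> ?C" for y
    using R[OF \<open>w \<in> A\<close>] that unfolding Unp_iff[symmetric] by blast
  define \<pi> where "\<pi> y = (THE a. nearest A y a)" for y
  have \<pi>: "nearest A y (\<pi> y)" if "y \<in> ?C" for y
    unfolding \<pi>_def using theI'[OF uniq[OF that]] .
  have \<pi>_eq: "\<pi> y = a" if "y \<in> ?C" "nearest A y a" for y a
    using \<pi>[OF that(1)] uniq[OF that(1)] that(2) by auto
  have \<pi>A: "\<pi> y \<in> A" if "y \<in> ?C" for y
    using \<pi>[OF that] by (simp add: nearest_def)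
  \<comment> \<open>Being nearest is a closed condition and \<open>A\<close> is compact, so
    \<open>\<pi>\<close> is continuous because its graph is closed.\<close>
  have "continuous_on ?C \<pi>"
  proof (rule continuous_from_closed_graph[OF \<open>compact A\<close>])
    show "\<pi> \<in> ?C \<rightarrow> A" using \<pi>A by auto
    have "(\<lambda>y. (y, \<pi> y)) ` ?C = (?C \<times> A) \<inter> {p. dist (fst p) (snd p) = infdist (fst p) A}"
      using \<pi> \<pi>_eq by (fastforce simp: nearest_def)
    moreover have "closed ((?C \<times> A) \<inter> {p. dist (fst p) (snd p) = infdist (fst p) A})"
      by (intro closed_Int closed_Times closed_cball compact_imp_closed[OF \<open>compact A\<close>]
          closed_Collect_eq continuous_intros)
    ultimately show "closed ((\<lambda>y. (y, \<pi> y)) ` ?C)" by simp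
  qed
  have ne: "x \<noteq> \<pi> y" if "y \<in> ?C" for y
    using \<pi>A[OF that] \<open>x \<notin> A\<close> by auto
  \<comment> \<open>At a fixed point \<open>y\<close> of \<open>f\<close>, \<open>x\<close> lies on the segment from \<open>\<pi> y\<close> to \<open>y\<close>, which forces \<open>\<pi> y = \<pi> x\<close>.\<close>
  define f where "f y = x + (\<epsilon> / norm (x - \<pi> y)) *\<^sub>R (x - \<pi> y)" for y
  have "continuous_on ?C f"
    unfolding f_def using ne by (intro continuous_intros \<open>continuous_on ?C \<pi>\<close>) auto
  moreover have fdist: "dist x (f y) = \<epsilon>" if "y \<in> ?C" for y
    using ne[OF that] \<open>\<epsilon> > 0\<close> by (simp add: f_def dist_norm)
  ultimately obtain y where y: "y \<in> ?C" "f y = y"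
    using brouwer_ball[OF \<open>\<epsilon> > 0\<close>, of x f] by (force simp: Pi_iff)
  define a where "a = \<pi> y"
  have a: "nearest A y a" "x \<noteq> a" using \<pi> ne y(1) by (auto simp: a_def)
  have yx: "y - a = (1 + \<epsilon> / norm (x - a)) *\<^sub>R (x - a)"
    using y(2) by (simp add: f_def a_def algebra_simps)
  have dya: "dist y a = dist x a + \<epsilon>"
    unfolding dist_norm yx norm_scaleR using a(2) \<open>\<epsilon> > 0\<close> by (simp add: distrib_right)
  have dyx: "dist y x = \<epsilon>"
    using fdist[OF y(1)] y(2) by (simp add: dist_commute)
  have "nearest A x a"
  proof (rule nearestI)
    show "a \<in> A" using a by (simp add: nearest_def)
    fix q assume "q \<in> A"
    then have "dist y a \<le> dist y q" using a nearest_le by blast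
    also have "\<dots> \<le> dist y x + dist x q" by (rule dist_triangle)
    finally show "dist x a \<le> dist x q" using dya dyx by simp
  qed
  moreover have "x \<in> ?C" using \<open>\<epsilon> > 0\<close> by simp
  ultimately have "a = w" using w uniq by blast
  then show ?thesis
    using a(1) y(2) by (simp add: f_def a_def dist_norm)
qed

text \<open>With n the unit vector along \<open>z - w\<close>, the inequality says that
  \<open>q\<close> lies outside the open ball of radius \<open>R\<close> centred at
  \<open>w + R n\<close>. Multiplying by \<open>norm (z - w)\<close> avoids a division.\<close>

definition exterior_balls :: "real \<Rightarrow> 'a::real_inner set \<Rightarrow> bool" where
  "exterior_balls R A \<longleftrightarrow> (\<forall>z w q. z \<notin> A \<longrightarrow> nearest A z w \<longrightarrow> dist z w < R \<longrightarrow> q \<in> A \<longrightarrow>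
     2 * R * ((z - w) \<bullet> (q - w)) \<le> norm (z - w) * (norm (q - w))\<^sup>2)"

lemma nearest_imp_inner_le:
  fixes z :: "'a::real_inner"
  assumes "nearest A z w" "q \<in> A"
  shows "2 * ((z - w) \<bullet> (q - w)) \<le> (norm (q - w))\<^sup>2"
proof -
  have "norm (z - w) \<le> norm (z - w - (q - w))"
    using nearest_le[OF assms] by (simp add: dist_norm)
  then have "(norm (z - w))\<^sup>2 \<le> (norm (z - w - (q - w)))\<^sup>2"
    by (simp add: power_mono)
  then show ?thesis
    by (simp add: power2_norm_eq_inner inner_diff_left inner_diff_right inner_commute algebra_simps)
qed

lemma reach_imp_exterior_balls:
  fixes A :: "'a::euclidean_space set"
  assumes "compact A" and R: "\<And>a. a \<in> A \<Longrightarrow> ball a R \<subseteq> Unp A"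
  shows "exterior_balls (R / 2) A"
  unfolding exterior_balls_def
proof (intro allI impI)
  fix z w q assume z: "z \<notin> A" "nearest A z w" "dist z w < R / 2" "q \<in> A"
  define d where "d = dist z w"
  have "z \<noteq> w" using z by (auto simp: nearest_def)
  then have "d > 0" by (simp add: d_def)
  \<comment> \<open>The point at distance \<open>R / 2\<close> from \<open>w\<close> on the ray
    through \<open>z\<close>. The extension needs a total distance strictly below \<open>R\<close>,
    which \<open>R / 2\<close> ensures.\<close>
  define y where "y = z + ((R / 2 - d) / d) *\<^sub>R (z - w)"
  have "nearest A y w"
    unfolding y_def d_def by (rule nearest_extend[OF assms]) (use z \<open>d > 0\<close> in \<open>auto simp: d_def intro: le_less_trans[of 0 "dist z w * 2"]\<close>)
  then have "2 * ((y - w) \<bullet> (q - w)) \<le> (norm (q - w))\<^sup>2"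
    using z(4) by (rule nearest_imp_inner_le)
  moreover have "y - w = (R / 2 / d) *\<^sub>R (z - w)"
    using \<open>d > 0\<close> by (simp add: y_def diff_divide_distrib algebra_simps)
  ultimately have "2 * (R / 2 / d * ((z - w) \<bullet> (q - w))) \<le> (norm (q - w))\<^sup>2" by simp
  then show "2 * (R / 2) * ((z - w) \<bullet> (q - w)) \<le> norm (z - w) * (norm (q - w))\<^sup>2"
    using \<open>d > 0\<close> by (simp add: d_def dist_norm field_simps)
qed

text \<open>Writing m for the point of the segment, \<open>(m - w) \<bullet> (m - w)\<close> is the
  convex combination of \<open>(m - w) \<bullet> (p - w)\<close> and
  \<open>(m - w) \<bullet> (q - w)\<close>, and each of these is bounded by the exterior ball at
  \<open>w\<close>. The weighted squares add up to
  \<open>d\<^sup>2 + u * v * (dist p q)\<^sup>2\<close>, and since \<open>d < R\<close> the term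
  \<open>d\<^sup>2\<close> is absorbed on the left.\<close>

lemma exterior_balls_near_segment:
  fixes A :: "'a::real_inner set"
  assumes "exterior_balls R A" "R > 0" "p \<in> A" "q \<in> A" "0 \<le> u" "0 \<le> v" "u + v = 1"
    and w: "nearest A (u *\<^sub>R p + v *\<^sub>R q) w" and d: "dist (u *\<^sub>R p + v *\<^sub>R q) w < R"
  shows "dist (u *\<^sub>R p + v *\<^sub>R q) w \<le> u * v * (dist p q)\<^sup>2 / R"
proof (cases "u *\<^sub>R p + v *\<^sub>R q \<in> A")
  case True
  then have "dist (u *\<^sub>R p + v *\<^sub>R q) w = 0" using nearest_le[OF w True] by simp
  then show ?thesis using assms by simp
next
  case False
  define m where "m = u *\<^sub>R p + v *\<^sub>R q"
  define d where "d = norm (m - w)"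
  have "w \<in> A" using w by (simp add: nearest_def)
  then have "d > 0" using False by (auto simp: d_def m_def)
  have "d < R" using assms(9) by (simp add: d_def m_def dist_norm)
  have v: "v = 1 - u" using assms by simp
  have ineq: "2 * R * ((m - w) \<bullet> (x - w)) \<le> d * (norm (x - w))\<^sup>2" if "x \<in> A" for x
    using assms(1) False w \<open>d < R\<close> that by (simp add: exterior_balls_def m_def d_def dist_norm)
  have "d\<^sup>2 = (m - w) \<bullet> (m - w)" by (simp add: d_def power2_norm_eq_inner)
  also have "\<dots> = u * ((m - w) \<bullet> (p - w)) + v * ((m - w) \<bullet> (q - w))"
    by (simp add: m_def v inner_add_right inner_diff_right algebra_simps)
  finally have "2 * R * d\<^sup>2 = u * (2 * R * ((m - w) \<bullet> (p - w))) + v * (2 * R * ((m - w) \<bullet> (q - w)))"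
    by algebra
  also have "\<dots> \<le> u * (d * (norm (p - w))\<^sup>2) + v * (d * (norm (q - w))\<^sup>2)"
    using ineq assms by (intro add_mono mult_left_mono) auto
  also have "\<dots> = d * (u * (norm (p - w))\<^sup>2 + v * (norm (q - w))\<^sup>2)"
    by (simp add: algebra_simps)
  also have "u * (norm (p - w))\<^sup>2 + v * (norm (q - w))\<^sup>2 = d\<^sup>2 + u * v * (dist p q)\<^sup>2"
    unfolding d_def m_def dist_norm v power2_norm_eq_inner
    by (simp add: inner_add_left inner_add_right inner_diff_left inner_diff_right inner_commute algebra_simps)
  finally have "d * (2 * R * d) \<le> d * (d\<^sup>2 + u * v * (dist p q)\<^sup>2)"
    by (simp add: power2_eq_square algebra_simps)
  then have "2 * R * d \<le> d\<^sup>2 + u * v * (dist p q)\<^sup>2"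
    using \<open>d > 0\<close> by (rule mult_left_le_imp_le)
  moreover have "d\<^sup>2 \<le> R * d"
    using \<open>d < R\<close> \<open>d > 0\<close> by (simp add: power2_eq_square)
  ultimately have "d * R \<le> u * v * (dist p q)\<^sup>2" by (simp add: algebra_simps)
  then show ?thesis
    using assms(2) by (simp add: pos_le_divide_eq d_def m_def dist_norm)
qed

section \<open>Midpoint estimates imply positive reach\<close>

definition near_midconvex_at :: "'a::real_normed_vector set \<Rightarrow> 'a \<Rightarrow> bool" where
  "near_midconvex_at A a \<longleftrightarrow> (\<exists>\<epsilon>>0. \<exists>C\<ge>0. \<forall>p\<in>A \<inter> ball a \<epsilon>. \<forall>q\<in>A \<inter> ball a \<epsilon>.
     \<exists>w\<in>A. dist w (midpoint p q) \<le> C * (dist p q)\<^sup>2)"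

text \<open>Two nearest points of \<open>z\<close> at distance \<open>d\<close> from
  \<open>z\<close> and \<open>b\<close> from each other have a midpoint at squared distance
  \<open>d\<^sup>2 - b\<^sup>2 / 4\<close> from \<open>z\<close>. As \<open>A\<close> comes within
  \<open>C * b\<^sup>2\<close> of that midpoint but not closer than \<open>d\<close> to
  \<open>z\<close>, squaring gives \<open>1/4 \<le> 2 * C * d\<close>, which fails for small
  \<open>d\<close>.\<close>

lemma near_midconvex_imp_ball_Unp:
  fixes A :: "'a::euclidean_space set"
  assumes "closed A" "a \<in> A" "near_midconvex_at A a"
  shows "\<exists>\<delta>>0. ball a \<delta> \<subseteq> Unp A"
proof -
  obtain \<epsilon> C where "\<epsilon> > 0" "C \<ge> 0"
    and mid: "\<And>p q. p \<in> A \<Longrightarrow> q \<in> A \<Longrightarrow> dist a p < \<epsilon> \<Longrightarrow> dist a q < \<epsilon> \<Longrightarrow>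
       \<exists>w\<in>A. dist w (midpoint p q) \<le> C * (dist p q)\<^sup>2"
    using assms(3) unfolding near_midconvex_at_def by (auto simp: Ball_def)
  \<comment> \<open>The first bound keeps both nearest points within \<open>\<epsilon>\<close> of
    \<open>a\<close>; the second gives \<open>8 * C * d < 1\<close>, where the summand 1 covers the
    case \<open>C = 0\<close>.\<close>
  define \<delta> where "\<delta> = min (\<epsilon> / 2) (1 / (8 * (C + 1)))"
  have "\<delta> > 0" using \<open>\<epsilon> > 0\<close> \<open>C \<ge> 0\<close> by (simp add: \<delta>_def)
  moreover have "z \<in> Unp A" if z: "z \<in> ball a \<delta>" for z
  proof -
    obtain p where p: "nearest A z p"
      using nearest_exists[OF assms(1)] assms(2) by blast
    moreover have "q = p" if q: "nearest A z q" for q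
    proof (rule ccontr)
      assume "q \<noteq> p"
      define d where "d = dist z p"
      have dq: "dist z q = d" using p q by (simp add: nearest_def d_def)
      have "d \<le> dist z a" using nearest_le[OF p assms(2)] by (simp add: d_def)
      also have "\<dots> < \<delta>" using z by (simp add: dist_commute)
      finally have "d < \<delta>" .
      have near: "dist a x < \<epsilon>" if "dist z x = d" for x
        using dist_triangle[of a x z] z \<open>d < \<delta>\<close> that by (simp add: \<delta>_def)
      obtain w where w: "w \<in> A" "dist w (midpoint p q) \<le> C * (dist p q)\<^sup>2"
        using mid[of p q] near[OF dq] near[of p] p q by (auto simp: nearest_def d_def)
      define b where "b = dist p q"
      have "b > 0" using \<open>q \<noteq> p\<close> by (simp add: b_def)
      have "b \<le> 2 * d" using dist_triangle[of p q z] dq by (simp add: b_def d_def dist_commute)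
      have med: "(dist z (midpoint p q))\<^sup>2 = d\<^sup>2 - b\<^sup>2 / 4"
      proof -
        have e: "(dist z (midpoint p q))\<^sup>2 = ((dist z p)\<^sup>2 + (dist z q)\<^sup>2) / 2 - (dist p q)\<^sup>2 / 4"
          by (simp add: dist_norm midpoint_def power2_norm_eq_inner inner_add_left inner_add_right
              inner_diff_left inner_diff_right inner_commute field_simps)
        show ?thesis unfolding e dq b_def by (simp add: d_def)
      qed
      have "d \<le> dist z w" using nearest_le[OF p w(1)] by (simp add: d_def)
      also have "\<dots> \<le> dist z (midpoint p q) + C * b\<^sup>2"
        using dist_triangle[of z w "midpoint p q"] w(2) by (simp add: b_def dist_commute)
      finally have le: "d - C * b\<^sup>2 \<le> dist z (midpoint p q)" by simp
      have small: "8 * C * d < 1"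
      proof -
        have "d < 1 / (8 * (C + 1))" using \<open>d < \<delta>\<close> by (simp add: \<delta>_def)
        then have "8 * (C + 1) * d < 1" using \<open>C \<ge> 0\<close> by (simp add: field_simps)
        moreover have "0 \<le> d" by (simp add: d_def)
        ultimately show ?thesis by (simp add: algebra_simps)
      qed
      have "b\<^sup>2 \<le> 4 * d\<^sup>2"
        using power_mono[OF \<open>b \<le> 2 * d\<close>, of 2] \<open>b > 0\<close> by (simp add: power2_eq_square)
      then have "C * b\<^sup>2 \<le> C * (4 * d\<^sup>2)"
        using \<open>C \<ge> 0\<close> by (rule mult_left_mono)
      also have "\<dots> = (8 * C * d) * d / 2" by (simp add: power2_eq_square)
      also have "\<dots> \<le> 1 * d / 2"
        using small by (intro divide_right_mono mult_right_mono) (auto simp: d_def)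
      \<comment> \<open>Nonnegativity is what allows the inequality \<open>le\<close> to be
        squared.\<close>
      finally have "0 \<le> d - C * b\<^sup>2" using zero_le_dist[of z p] unfolding d_def by linarith
      then have "(d - C * b\<^sup>2)\<^sup>2 \<le> d\<^sup>2 - b\<^sup>2 / 4"
        using power_mono[OF le, of 2] med by simp
      then have "b\<^sup>2 * (1/4) + (C * b\<^sup>2)\<^sup>2 \<le> b\<^sup>2 * (2 * C * d)"
        by (simp add: power2_diff algebra_simps)
      then have "b\<^sup>2 * (1/4) \<le> b\<^sup>2 * (2 * C * d)"
        using zero_le_power2[of "C * b\<^sup>2"] by linarith
      then have "1/4 \<le> 2 * C * d" using \<open>b > 0\<close> by (simp add: mult_le_cancel_left)
      then show False using small by simp
    qed
    ultimately show ?thesis unfolding Unp_iff by blast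
  qed
  ultimately show ?thesis by blast
qed

lemma near_midconvex_imp_positive_reach:
  fixes A :: "'a::euclidean_space set"
  assumes "compact A" "A \<noteq> {}" "\<And>a. a \<in> A \<Longrightarrow> near_midconvex_at A a"
  shows "positive_reach A"
proof -
  \<comment> \<open>A Lebesgue number of this cover by a single open set is a radius that works at
    all points of \<open>A\<close>.\<close>
  have "A \<subseteq> \<Union>{interior (Unp A)}"
    using near_midconvex_imp_ball_Unp[OF compact_imp_closed[OF assms(1)]] assms(3)
    by (auto simp: mem_interior)
  then obtain R where "R > 0" "\<And>x. x \<in> A \<Longrightarrow> \<exists>G\<in>{interior (Unp A)}. ball x R \<subseteq> G"
    using Heine_Borel_lemma[OF assms(1), of "{interior (Unp A)}"] by blast
  then have "\<forall>a\<in>A. ball a R \<subseteq> Unp A"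
    using interior_subset by blast
  then show ?thesis
    using \<open>R > 0\<close> positive_reach_iff_uniform[OF assms(2)] by blast
qed

section \<open>The midpoint estimate for sets of type T\<close>

definition mid_semiconcave :: "real set \<Rightarrow> real \<Rightarrow> (real \<Rightarrow> real) \<Rightarrow> bool" where
  "mid_semiconcave D k f \<longleftrightarrow>
     (\<forall>x\<in>D. \<forall>y\<in>D. (x + y) / 2 \<in> D \<and> (f x + f y) / 2 - k * (x - y)\<^sup>2 \<le> f ((x + y) / 2))"

lemma semiconcave_imp_mid_semiconcave:
  assumes "semiconcave_on D f"
  obtains k where "k \<ge> 0" "mid_semiconcave D k f"
proof -
  obtain c where c: "c \<ge> 0" "concave_on D (\<lambda>x. f x - c / 2 * \<bar>x\<bar>\<^sup>2)"
    using assms unfolding semiconcave_on_def by blast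
  have "(x + y) / 2 \<in> D \<and> (f x + f y) / 2 - c / 8 * (x - y)\<^sup>2 \<le> f ((x + y) / 2)"
    if "x \<in> D" "y \<in> D" for x y
  proof -
    have "(1 - 1/2) *\<^sub>R x + (1/2) *\<^sub>R y = (x + y) / 2" by simp
    moreover have "(1 - 1/2) *\<^sub>R x + (1/2) *\<^sub>R y \<in> D"
      using concave_on_imp_convex[OF c(2)] that by (intro convexD) auto
    ultimately show ?thesis
      using concave_onD[OF c(2), of "1/2" x y] that
      by (simp add: power2_eq_square field_simps)
  qed
  then show thesis
    \<comment> \<open>The constant comes from \<open>c / 2\<close> times
      \<open>(x - y)\<^sup>2 / 4\<close>, the amount by which the mean of the squares exceeds the
      square of the mean.\<close>
    using that[of "c / 8"] c(1) by (auto simp: mid_semiconcave_def)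
qed

text \<open>Type 3 provides semiconcavity only on the open interval, while the set includes the
  section over 0. Shifting both points to the right by \<open>t\<close> leaves their difference
  unchanged, and continuity lets \<open>t\<close> tend to 0.\<close>

lemma mid_semiconcave_extend_left:
  assumes "is_lipschitz_on {0..<r} f" "mid_semiconcave {0<..<r} k f"
  shows "mid_semiconcave {0..<r} k f"
  unfolding mid_semiconcave_def
proof (intro ballI conjI)
  fix x y assume xy: "x \<in> {0..<r}" "y \<in> {0..<r}"
  then show mid: "(x + y) / 2 \<in> {0..<r}" by auto
  have cont: "continuous_on {0..<r} f"
    using assms(1) lipschitz_on_continuous_on by (auto simp: is_lipschitz_on_def)
  have lim: "((\<lambda>t. f (z + t)) \<longlongrightarrow> f z) (at_right 0)" if z: "z \<in> {0..<r}" for z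
  proof -
    have "(f \<longlongrightarrow> f z) (at z within {0..<r})"
      using cont z by (simp add: continuous_on)
    moreover have "filterlim (\<lambda>t. z + t) (at z within {0..<r}) (at_right 0)"
      unfolding filterlim_at
    proof
      show "\<forall>\<^sub>F t in at_right 0. z + t \<in> {0..<r} \<and> z + t \<noteq> z"
        using z unfolding eventually_at_right_field
        by (intro exI[of _ "r - z"]) auto
      have "((\<lambda>t. z + t) \<longlongrightarrow> z + 0) (at_right 0)" by (intro tendsto_intros)
      then show "((\<lambda>t. z + t) \<longlongrightarrow> z) (at_right 0)" by simp
    qed
    ultimately show ?thesis by (rule filterlim_compose)
  qed
  have ev: "\<forall>\<^sub>F t in at_right 0.
      (f (x + t) + f (y + t)) / 2 - k * (x - y)\<^sup>2 \<le> f ((x + y) / 2 + t)"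
    unfolding eventually_at_right_field
  proof (intro exI[of _ "min (r - x) (r - y)"] conjI allI impI)
    show "0 < min (r - x) (r - y)" using xy by simp
    fix t assume t: "0 < t" "t < min (r - x) (r - y)"
    have e: "(x + t + (y + t)) / 2 = (x + y) / 2 + t" by (simp add: field_simps)
    have "x + t \<in> {0<..<r}" "y + t \<in> {0<..<r}" using xy t by auto
    then have "(f (x + t) + f (y + t)) / 2 - k * (x + t - (y + t))\<^sup>2 \<le> f ((x + t + (y + t)) / 2)"
      using assms(2) unfolding mid_semiconcave_def by blast
    then show "(f (x + t) + f (y + t)) / 2 - k * (x - y)\<^sup>2 \<le> f ((x + y) / 2 + t)"
      unfolding e by simp
  qed
  show "(f x + f y) / 2 - k * (x - y)\<^sup>2 \<le> f ((x + y) / 2)"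
    by (rule tendsto_le[OF _ lim[OF mid] _ ev])
       (auto intro!: tendsto_intros lim xy)
qed

definition near_midconvex :: "real \<Rightarrow> 'a::real_normed_vector set \<Rightarrow> bool" where
  "near_midconvex k S \<longleftrightarrow> (\<forall>p\<in>S. \<forall>q\<in>S. \<exists>w\<in>S. dist w (midpoint p q) \<le> k * (dist p q)\<^sup>2)"

lemma midpoint_Pair: "midpoint (x, y) (x', y') = (midpoint x x', midpoint y y')"
  by (simp add: midpoint_def)

lemma midpoint_real: "midpoint x y = (x + y) / 2" for x y :: real
  by (simp add: midpoint_def)

lemma clamp_near:
  fixes t :: real
  assumes "0 \<le> e" "t - e \<le> u" "l \<le> t + e" "l \<le> u"
  shows "\<bar>max l (min u t) - t\<bar> \<le> e"
  using assms by (auto simp: max_def min_def abs_le_iff)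

lemma near_midconvex_hypo:
  assumes "k \<ge> 0" "mid_semiconcave D k f"
  shows "near_midconvex k (hypo D f)"
  unfolding near_midconvex_def
proof (intro ballI)
  fix p q assume "p \<in> hypo D f" "q \<in> hypo D f"
  then obtain x y x' y' where pq: "p = (x, y)" "q = (x', y')" "x \<in> D" "x' \<in> D" "y \<le> f x" "y' \<le> f x'"
    by (auto simp: hypo_def)
  define m where "m = (x + x') / 2"
  have m: "m \<in> D" "(f x + f x') / 2 - k * (x - x')\<^sup>2 \<le> f m"
    using assms(2) pq by (auto simp: mid_semiconcave_def m_def)
  \<comment> \<open>The abscissa of the midpoint is kept; only its height is lowered, if necessary,
    to the graph.\<close>
  define w where "w = (m, min (f m) ((y + y') / 2))"
  have "k * (x - x')\<^sup>2 \<le> k * (dist p q)\<^sup>2"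
    using assms(1) pq by (intro mult_left_mono) (auto simp: dist_Pair_Pair dist_real_def)
  moreover have "\<bar>min (f m) ((y + y') / 2) - (y + y') / 2\<bar> \<le> k * (x - x')\<^sup>2"
  proof -
    have "0 \<le> k * (x - x')\<^sup>2" using assms(1) by simp
    moreover have "(y + y') / 2 - k * (x - x')\<^sup>2 \<le> f m" using m(2) pq(5,6) by argo
    ultimately show ?thesis
      using clamp_near[of "k * (x - x')\<^sup>2" "(y + y') / 2" "f m" "min (f m) ((y + y') / 2)"] by simp
  qed
  ultimately have "dist w (midpoint p q) \<le> k * (dist p q)\<^sup>2"
    by (simp add: pq(1,2) midpoint_Pair midpoint_real w_def m_def dist_Pair_Pair dist_real_def)
  moreover have "w \<in> hypo D f" using m by (simp add: w_def hypo_def)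
  ultimately show "\<exists>w\<in>hypo D f. dist w (midpoint p q) \<le> k * (dist p q)\<^sup>2" by blast
qed

text \<open>The height of the midpoint is clamped into the section from both sides. Because the
  section over the middle abscissa is a nonempty interval, correcting one side does not violate the
  other.\<close>

lemma near_midconvex_hypo_epi:
  assumes "k \<ge> 0" "mid_semiconcave D k f" "mid_semiconcave D k (\<lambda>x. - g x)" "\<forall>x\<in>D. g x \<le> f x"
  shows "near_midconvex k (hypo D f \<inter> epi D g)"
  unfolding near_midconvex_def
proof (intro ballI)
  fix p q assume "p \<in> hypo D f \<inter> epi D g" "q \<in> hypo D f \<inter> epi D g"
  then obtain x y x' y' where pq: "p = (x, y)" "q = (x', y')" "x \<in> D" "x' \<in> D"
    "y \<le> f x" "y' \<le> f x'" "g x \<le> y" "g x' \<le> y'"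
    by (auto simp: hypo_def epi_def)
  define m where "m = (x + x') / 2"
  have m: "m \<in> D" "(f x + f x') / 2 - k * (x - x')\<^sup>2 \<le> f m"
      "(- g x + - g x') / 2 - k * (x - x')\<^sup>2 \<le> - g m" "g m \<le> f m"
    using assms(2-4) pq unfolding mid_semiconcave_def m_def by blast+
  define h where "h = max (g m) (min (f m) ((y + y') / 2))"
  have "k * (x - x')\<^sup>2 \<le> k * (dist p q)\<^sup>2"
    using assms(1) pq by (intro mult_left_mono) (auto simp: dist_Pair_Pair dist_real_def)
  moreover have "\<bar>h - (y + y') / 2\<bar> \<le> k * (x - x')\<^sup>2"
  proof -
    have "0 \<le> k * (x - x')\<^sup>2" using assms(1) by simp
    moreover have "(y + y') / 2 - k * (x - x')\<^sup>2 \<le> f m" "g m \<le> (y + y') / 2 + k * (x - x')\<^sup>2"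
      using m(2,3) pq(5-8) by argo+
    ultimately show ?thesis
      unfolding h_def using m(4) by (rule clamp_near)
  qed
  ultimately have "dist (m, h) (midpoint p q) \<le> k * (dist p q)\<^sup>2"
    by (simp add: pq(1,2) midpoint_Pair midpoint_real m_def dist_Pair_Pair dist_real_def)
  moreover have "(m, h) \<in> hypo D f \<inter> epi D g" using m by (auto simp: h_def hypo_def epi_def)
  ultimately show "\<exists>w\<in>hypo D f \<inter> epi D g. dist w (midpoint p q) \<le> k * (dist p q)\<^sup>2" by blast
qed

lemma mid_semiconcave_mono:
  assumes "mid_semiconcave D k f" "k \<le> k'"
  shows "mid_semiconcave D k' f"
  unfolding mid_semiconcave_def
proof (intro ballI conjI)
  fix x y assume xy: "x \<in> D" "y \<in> D"
  then show "(x + y) / 2 \<in> D" using assms(1) by (auto simp: mid_semiconcave_def)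
  have "k * (x - y)\<^sup>2 \<le> k' * (x - y)\<^sup>2" using assms(2) by (intro mult_right_mono) auto
  moreover have "(f x + f y) / 2 - k * (x - y)\<^sup>2 \<le> f ((x + y) / 2)"
    using assms(1) xy by (auto simp: mid_semiconcave_def)
  ultimately show "(f x + f y) / 2 - k' * (x - y)\<^sup>2 \<le> f ((x + y) / 2)" by linarith
qed

text \<open>The ball is kept apart from \<open>S\<close>: a corrected midpoint stays in the
  hypograph and epigraph but may leave the ball. That is repaired later by taking both points closer
  to the origin.\<close>

lemma T_tilde_imp_near_midconvex:
  assumes "T_tilde i r M"
  obtains k S where "k \<ge> 0" "near_midconvex k S" "M = ball 0 r \<inter> S"
proof -
  have "i = 1 \<and> T1_tilde r M \<or> i = 2 \<and> T2_tilde r M \<or> i = 3 \<and> T3_tilde r M"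
    using assms by (simp add: T_tilde_def)
  then consider "T1_tilde r M" | "T2_tilde r M" | "T3_tilde r M" by blast
  then show thesis
  proof cases
    case 1
    then obtain \<phi> where \<phi>: "semiconcave_on {-r<..<r} \<phi>" "M = ball 0 r \<inter> hypo {-r<..<r} \<phi>"
      unfolding T1_tilde_def by blast
    obtain k where "k \<ge> 0" "mid_semiconcave {-r<..<r} k \<phi>"
      using semiconcave_imp_mid_semiconcave[OF \<phi>(1)] .
    then show thesis using that \<phi>(2) near_midconvex_hypo by blast
  next
    case 2
    then obtain \<phi> \<psi> where \<phi>: "semiconcave_on {-r<..<r} \<phi>" "semiconvex_on {-r<..<r} \<psi>"
        "\<forall>x\<in>{-r<..<r}. \<psi> x \<le> \<phi> x"
        "M = ball 0 r \<inter> hypo {-r<..<r} \<phi> \<inter> epi {-r<..<r} \<psi>"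
      unfolding T2_tilde_def by blast
    obtain k k' where k: "k \<ge> 0" "mid_semiconcave {-r<..<r} k \<phi>"
        "k' \<ge> 0" "mid_semiconcave {-r<..<r} k' (\<lambda>x. - \<psi> x)"
      using semiconcave_imp_mid_semiconcave \<phi>(1,2) unfolding semiconvex_on_def by metis
    have "near_midconvex (max k k') (hypo {-r<..<r} \<phi> \<inter> epi {-r<..<r} \<psi>)"
      using k \<phi>(3) by (intro near_midconvex_hypo_epi) (auto intro: mid_semiconcave_mono)
    then show thesis using that[of "max k k'"] k(1) \<phi>(4) by (simp add: Int_assoc le_max_iff_disj)
  next
    case 3
    then obtain \<phi> \<psi> where \<phi>: "semiconcave_on {0<..<r} \<phi>" "semiconvex_on {0<..<r} \<psi>"
        "is_lipschitz_on {0..<r} \<phi>" "is_lipschitz_on {0..<r} \<psi>"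
        "\<forall>x\<in>{0..<r}. \<psi> x \<le> \<phi> x"
        "M = ball 0 r \<inter> hypo {0..<r} \<phi> \<inter> epi {0..<r} \<psi>"
      unfolding T3_tilde_def by blast
    have lip: "is_lipschitz_on {0..<r} (\<lambda>x. - \<psi> x)"
      using \<phi>(4) by (simp add: is_lipschitz_on_def)
    obtain k k' where k: "k \<ge> 0" "mid_semiconcave {0<..<r} k \<phi>"
        "k' \<ge> 0" "mid_semiconcave {0<..<r} k' (\<lambda>x. - \<psi> x)"
      using semiconcave_imp_mid_semiconcave \<phi>(1,2) unfolding semiconvex_on_def by metis
    have "near_midconvex (max k k') (hypo {0..<r} \<phi> \<inter> epi {0..<r} \<psi>)"
      using k \<phi>(3,5) lip
      by (intro near_midconvex_hypo_epi mid_semiconcave_extend_left) (auto intro: mid_semiconcave_mono)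
    then show thesis using that[of "max k k'"] k(1) \<phi>(6) by (simp add: Int_assoc le_max_iff_disj)
  qed
qed

lemma midpoint_in_ball:
  fixes a :: "'a::real_normed_vector"
  assumes "p \<in> ball a e" "q \<in> ball a e"
  shows "midpoint p q \<in> ball a e"
  using closed_segment_subset[OF assms convex_ball] midpoint_in_closed_segment by (rule subsetD)

text \<open>After subtracting \<open>G 0\<close> the isometry fixes the origin and is therefore
  linear.\<close>

lemma isometry_midpoint:
  fixes G :: "'a::real_inner \<Rightarrow> 'a"
  assumes "isometry G"
  shows "G (midpoint p q) = midpoint (G p) (G q)"
proof -
  define L where "L x = G x - G 0" for x
  have "linear L"
    by (rule isometry_linear) (use assms in \<open>auto simp: L_def isometry_def dist_norm\<close>)
  then have "L (midpoint p q) = midpoint (L p) (L q)"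
    by (simp add: midpoint_def linear_add linear_scale)
  then show ?thesis
    using scaleR_half_double[of "G 0"]
    by (simp add: L_def midpoint_def scaleR_add_right scaleR_diff_right eq_diff_eq diff_eq_eq add.assoc
        del: scaleR_half_double)
qed

lemma of_type_T_imp_near_midconvex_at:
  assumes "of_type_T i A a"
  shows "near_midconvex_at A a"
proof -
  obtain G r where G: "isometry G" "G a = 0" "r > 0" "T_tilde i r (G ` (A \<inter> ball a r))"
    using assms unfolding of_type_T_def by blast
  obtain k S where k: "k \<ge> 0" "near_midconvex k S" "G ` (A \<inter> ball a r) = ball 0 r \<inter> S"
    using T_tilde_imp_near_midconvex[OF G(4)] .
  have Gd: "dist (G x) (G y) = dist x y" for x y using G(1) unfolding isometry_def by blast
  \<comment> \<open>The midpoint lies within \<open>r / 2\<close> of \<open>a\<close>. As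
    \<open>\<epsilon> \<le> 1\<close>, the error is at most \<open>k * (4 * \<epsilon>)\<close>,
    which the last bound makes smaller than \<open>r / 2\<close>. So the corrected point stays in
    \<open>ball 0 r\<close> and comes from a point of \<open>A\<close>.\<close>
  define \<epsilon> where "\<epsilon> = min (min 1 (r / 2)) (r / (8 * (k + 1)))"
  have "\<epsilon> > 0" using G(3) k(1) by (simp add: \<epsilon>_def)
  moreover have "\<exists>w\<in>A. dist w (midpoint p q) \<le> k * (dist p q)\<^sup>2"
    if "p \<in> A \<inter> ball a \<epsilon>" "q \<in> A \<inter> ball a \<epsilon>" for p q
  proof -
    have "p \<in> A \<inter> ball a r" "q \<in> A \<inter> ball a r" using that G(3) by (auto simp: \<epsilon>_def)
    then have "G p \<in> S" "G q \<in> S" using k(3) by blast+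
    then obtain w' where w': "w' \<in> S" "dist w' (G (midpoint p q)) \<le> k * (dist p q)\<^sup>2"
      using k(2) Gd[of p q] isometry_midpoint[OF G(1)] unfolding near_midconvex_def by metis
    have pq: "dist p q \<le> 2 * \<epsilon>"
      using that dist_triangle[of p q a] by (simp add: dist_commute)
    have "k * (dist p q)\<^sup>2 \<le> k * (4 * \<epsilon>)"
    proof (rule mult_left_mono[OF _ k(1)])
      have "(dist p q)\<^sup>2 \<le> (2 * \<epsilon>)\<^sup>2" using pq by (intro power_mono) auto
      also have "\<dots> \<le> 4 * \<epsilon>"
        using \<open>\<epsilon> > 0\<close> mult_left_mono[of \<epsilon> 1 \<epsilon>] by (simp add: power2_eq_square \<epsilon>_def)
      finally show "(dist p q)\<^sup>2 \<le> 4 * \<epsilon>" .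
    qed
    also have "\<dots> < r / 2"
    proof -
      have "\<epsilon> \<le> r / (8 * (k + 1))" by (simp add: \<epsilon>_def)
      then have "(k + 1) * (8 * \<epsilon>) \<le> r" using k(1) by (simp add: field_simps)
      then show ?thesis using \<open>\<epsilon> > 0\<close> by (simp add: algebra_simps)
    qed
    finally have small: "dist w' (G (midpoint p q)) < r / 2" using w'(2) by linarith
    have "midpoint p q \<in> ball a \<epsilon>"
      using that by (intro midpoint_in_ball) auto
    then have "dist (G (midpoint p q)) 0 < r / 2"
      using Gd[of "midpoint p q" a] G(2) by (simp add: \<epsilon>_def dist_commute)
    then have "w' \<in> ball 0 r"
      using small dist_triangle[of w' 0 "G (midpoint p q)"] by (simp add: dist_commute)
    then obtain w where "w \<in> A" "w' = G w" using w'(1) k(3) by blast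
    then show ?thesis using w'(2) Gd by auto
  qed
  ultimately show ?thesis
    using k(1) unfolding near_midconvex_at_def by blast
qed

lemma near_midconvex_at_interior:
  assumes "a \<in> interior A"
  shows "near_midconvex_at A a"
proof -
  obtain e where e: "e > 0" "ball a e \<subseteq> A" using assms by (auto simp: mem_interior)
  have "midpoint p q \<in> A" if "p \<in> ball a e" "q \<in> ball a e" for p q
    using e midpoint_in_ball[OF that] by blast
  then show ?thesis
    using e unfolding near_midconvex_at_def
    by (rule_tac x=e in exI, intro conjI, simp, rule_tac x=0 in exI) auto
qed

lemma near_midconvex_at_isolated:
  fixes A :: "'a::real_normed_vector set"
  assumes "a \<in> isolated_pts A"
  shows "near_midconvex_at A a"
proof -
  obtain e where e: "e > 0" "\<forall>x\<in>A. dist a x < e \<longrightarrow> x = a"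
    using assms by (auto simp: isolated_pts_def isolated_in_dist_Ex_iff dist_commute)
  then show ?thesis
    unfolding near_midconvex_at_def
    by (rule_tac x=e in exI, intro conjI, simp, rule_tac x=0 in exI) fastforce
qed

lemma types_imp_positive_reach:
  assumes "compact A" "A \<noteq> {}"
    and "\<And>a. a \<in> frontier A - isolated_pts A \<Longrightarrow> \<exists>i\<in>{1, 2, 3}. of_type_T i A a"
  shows "positive_reach A"
proof (rule near_midconvex_imp_positive_reach[OF assms(1,2)])
  fix a assume "a \<in> A"
  then consider "a \<in> interior A" | "a \<in> isolated_pts A" | "a \<in> frontier A - isolated_pts A"
    using closure_subset[of A] by (auto simp: frontier_def)
  then show "near_midconvex_at A a"
    using near_midconvex_at_interior near_midconvex_at_isolated assms(3) of_type_T_imp_near_midconvex_at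
    by cases blast+
qed

section \<open>Local graph representation\<close>

lemma norm_Pair_le: "norm (x, y) \<le> \<bar>x\<bar> + \<bar>y\<bar>" for x y :: real
  by (simp add: norm_Pair sqrt_sum_squares_le_sum_abs)

lemma abs_fst_le: "\<bar>fst p\<bar> \<le> norm p" for p :: "real \<times> real"
  using norm_fst_le[of "fst p" "snd p"] by simp

lemma abs_snd_le: "\<bar>snd p\<bar> \<le> norm p" for p :: "real \<times> real"
  using norm_snd_le[of "snd p" "fst p"] by simp

text \<open>Collects what is needed about \<open>A\<close> near the origin once the axes are well
  placed. \<open>D\<close> is the horizontal range, a line or a half line in the applications, and
  \<open>L\<close> will be the Lipschitz constant. By \<open>cone_dichotomy\<close>, a missing point
  is the vertex of an upward cone above, or of a downward cone below, the nearby part of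
  \<open>A\<close>. The first bound in \<open>near_segment\<close> keeps the approximating point
  near the origin; the second is the quadratic estimate behind semiconcavity.\<close>

locale local_graph =
  fixes A :: "(real \<times> real) set" and D :: "real set" and \<delta> L K r :: real
  assumes closed_A: "closed A" and zero_A: "0 \<in> A" and r_pos: "0 < r" and r_le: "r \<le> \<delta> / 2"
    and L_nonneg: "0 \<le> L" and K_nonneg: "0 \<le> K" and convex_D: "convex D"
    and cone_dichotomy: "\<And>z. norm z < \<delta> \<Longrightarrow> z \<notin> A \<Longrightarrow> fst z \<in> D \<Longrightarrow>
      (\<forall>q\<in>A. norm q < \<delta> \<longrightarrow> snd q < snd z + L * \<bar>fst q - fst z\<bar>) \<or>
      (\<forall>q\<in>A. norm q < \<delta> \<longrightarrow> snd z - L * \<bar>fst q - fst z\<bar> < snd q)"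
    and section_nonempty: "\<And>x. x \<in> D \<Longrightarrow> \<bar>x\<bar> < r \<Longrightarrow> \<exists>y. (x, y) \<in> A \<and> \<bar>y\<bar> \<le> \<delta> / 2"
    and near_segment: "\<And>p q u v. p \<in> A \<Longrightarrow> q \<in> A \<Longrightarrow> norm p < \<delta> \<Longrightarrow> norm q < \<delta> \<Longrightarrow>
      0 \<le> u \<Longrightarrow> 0 \<le> v \<Longrightarrow> u + v = 1 \<Longrightarrow>
      \<exists>w\<in>A. dist w (u *\<^sub>R p + v *\<^sub>R q) \<le> norm (u *\<^sub>R p + v *\<^sub>R q) \<and>
        dist w (u *\<^sub>R p + v *\<^sub>R q) \<le> K * (u * v * (dist p q)\<^sup>2)"
    and fst_in_D: "\<And>p. p \<in> A \<Longrightarrow> norm p < \<delta> \<Longrightarrow> fst p \<in> D"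
    and section_zero: "\<And>y. (0, y) \<in> A \<Longrightarrow> \<bar>y\<bar> \<le> \<delta> / 2 \<Longrightarrow> y \<le> 0"
begin

text \<open>The top of the vertical section; the cut-off at height \<open>\<delta> / 2\<close>
  discards parts of \<open>A\<close> far from the origin. The value is meaningful over
  \<open>D\<close> for \<open>\<bar>x\<bar> < r\<close>, where the section is nonempty.\<close>

definition upper :: "real \<Rightarrow> real" where
  "upper x = Sup {y. (x, y) \<in> A \<and> \<bar>y\<bar> \<le> \<delta> / 2}"

lemma delta_pos: "0 < \<delta>"
  using r_pos r_le by linarith

lemma zero_D: "0 \<in> D"
  using fst_in_D[OF zero_A] delta_pos by simp

lemma norm_window:
  assumes "\<bar>x\<bar> < r" "\<bar>y\<bar> \<le> \<delta> / 2"
  shows "norm (x, y) < \<delta>"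
  using norm_Pair_le[of x y] assms r_le by linarith

lemma le_upper:
  assumes "(x, y) \<in> A" "\<bar>y\<bar> \<le> \<delta> / 2"
  shows "y \<le> upper x"
  unfolding upper_def
  by (rule cSup_upper) (use assms in \<open>auto intro!: bdd_aboveI[of _ "\<delta> / 2"]\<close>)

lemma upper_mem:
  assumes "x \<in> D" "\<bar>x\<bar> < r"
  shows "(x, upper x) \<in> A" "\<bar>upper x\<bar> \<le> \<delta> / 2"
proof -
  let ?S = "{y. (x, y) \<in> A \<and> \<bar>y\<bar> \<le> \<delta> / 2}"
  have "?S = (\<lambda>y. (x, y)) -` A \<inter> {- (\<delta> / 2)..\<delta> / 2}" by auto
  moreover have "closed ((\<lambda>y. (x, y)) -` A)"
    by (rule closed_vimage[OF closed_A]) (intro continuous_intros)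
  ultimately have "closed ?S" by (metis closed_Int closed_atLeastAtMost)
  moreover have "?S \<noteq> {}" using section_nonempty[OF assms] by blast
  moreover have "bdd_above ?S" by (rule bdd_aboveI[of _ "\<delta> / 2"]) auto
  ultimately have "Sup ?S \<in> ?S" by (intro closed_contains_Sup)
  then show "(x, upper x) \<in> A" "\<bar>upper x\<bar> \<le> \<delta> / 2" by (auto simp: upper_def)
qed

text \<open>Otherwise the point over \<open>x\<close> at height
  \<open>y' - L * \<bar>x' - x\<bar>\<close> would lie above the section, hence outside
  \<open>A\<close>. An upward cone from it has \<open>(x', y')\<close> on its boundary, and a
  downward cone has \<open>(x, upper x)\<close> underneath, so both alternatives of the dichotomy
  fail.\<close>

lemma upper_cone:
  assumes "x \<in> D" "\<bar>x\<bar> < r" "\<bar>x'\<bar> < r" "(x', y') \<in> A" "\<bar>y'\<bar> \<le> \<delta> / 2"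
  shows "y' \<le> upper x + L * \<bar>x' - x\<bar>"
proof (rule ccontr)
  assume neg: "\<not> ?thesis"
  define y where "y = y' - L * \<bar>x' - x\<bar>"
  have y: "upper x < y" using neg by (simp add: y_def)
  have "y \<le> y'" using L_nonneg by (simp add: y_def)
  then have win: "\<bar>y\<bar> \<le> \<delta> / 2" using y upper_mem(2)[OF assms(1,2)] assms(5) by linarith
  have "(x, y) \<notin> A" using le_upper[of x y] win y by auto
  then consider "\<forall>q\<in>A. norm q < \<delta> \<longrightarrow> snd q < y + L * \<bar>fst q - x\<bar>"
    | "\<forall>q\<in>A. norm q < \<delta> \<longrightarrow> y - L * \<bar>fst q - x\<bar> < snd q"
    using cone_dichotomy[of "(x, y)"] norm_window[OF assms(2) win] assms(1) by auto
  then show False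
  proof cases
    case 1
    then have "y' < y + L * \<bar>x' - x\<bar>"
      using assms(4) norm_window[OF assms(3,5)] by (metis fst_conv snd_conv)
    then show False by (simp add: y_def)
  next
    case 2
    then have "y - L * \<bar>x - x\<bar> < upper x"
      using upper_mem[OF assms(1,2)] norm_window[OF assms(2)] by (metis fst_conv snd_conv)
    then show False using y by simp
  qed
qed

text \<open>On the vertical line through its vertex a cone has no width, so a missing point would
  exclude either all higher or all lower points of \<open>A\<close> on that line.\<close>

lemma vertically_convex:
  assumes "x \<in> D" "\<bar>x\<bar> < r" "(x, l) \<in> A" "\<bar>l\<bar> \<le> \<delta> / 2" "(x, u) \<in> A" "\<bar>u\<bar> \<le> \<delta> / 2"
    and "l \<le> y" "y \<le> u"
  shows "(x, y) \<in> A"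
proof (rule ccontr)
  assume "(x, y) \<notin> A"
  moreover have "\<bar>y\<bar> \<le> \<delta> / 2" using assms by linarith
  ultimately consider "\<forall>q\<in>A. norm q < \<delta> \<longrightarrow> snd q < y + L * \<bar>fst q - x\<bar>"
    | "\<forall>q\<in>A. norm q < \<delta> \<longrightarrow> y - L * \<bar>fst q - x\<bar> < snd q"
    using cone_dichotomy[of "(x, y)"] norm_window[OF assms(2)] assms(1) by auto
  then show False
  proof cases
    case 1
    then have "u < y + L * \<bar>x - x\<bar>"
      using assms(5) norm_window[OF assms(2,6)] by (metis fst_conv snd_conv)
    then show False using assms by simp
  next
    case 2
    then have "y - L * \<bar>x - x\<bar> < l"
      using assms(3) norm_window[OF assms(2,4)] by (metis fst_conv snd_conv)
    then show False using assms by simp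
  qed
qed

lemma upper_zero: "upper 0 = 0"
proof (rule antisym)
  show "upper 0 \<le> 0" using upper_mem[OF zero_D] r_pos by (intro section_zero) auto
  show "0 \<le> upper 0" using le_upper[of 0 0] zero_A delta_pos by (simp add: zero_prod_def)
qed

lemma upper_lipschitz: "L-lipschitz_on (D \<inter> {-r<..<r}) upper"
proof (rule lipschitz_onI)
  fix x x' assume "x \<in> D \<inter> {-r<..<r}" "x' \<in> D \<inter> {-r<..<r}"
  then have x: "x \<in> D" "\<bar>x\<bar> < r" "x' \<in> D" "\<bar>x'\<bar> < r" by auto
  show "dist (upper x) (upper x') \<le> L * dist x x'"
    using upper_cone[OF x(1,2,4) upper_mem[OF x(3,4)]] upper_cone[OF x(3,4,2) upper_mem[OF x(1,2)]]
    by (simp add: dist_real_def abs_le_iff abs_minus_commute)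
qed (rule L_nonneg)

lemma abs_upper_le:
  assumes "x \<in> D" "\<bar>x\<bar> < r"
  shows "\<bar>upper x\<bar> \<le> L * \<bar>x\<bar>"
proof -
  have "x \<in> D \<inter> {-r<..<r}" "0 \<in> D \<inter> {-r<..<r}" using assms zero_D r_pos by auto
  from lipschitz_onD[OF upper_lipschitz this] show ?thesis
    by (simp add: upper_zero dist_real_def)
qed

text \<open>A convex combination \<open>m\<close> of two graph points has a point \<open>w\<close>
  of \<open>A\<close> within quadratic distance. Moving from the abscissa of \<open>w\<close> back
  to that of \<open>m\<close> costs a factor \<open>L\<close> by \<open>upper_cone\<close>, so the
  graph over \<open>m\<close> is at most \<open>(1 + L) * dist w m\<close> below \<open>m\<close>.
  The factor \<open>1 + L\<^sup>2\<close> converts distances between graph points into horizontal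
  ones.\<close>

lemma upper_concave:
  assumes r': "r' = r / (4 * (1 + L))"
  shows "concave_on (D \<inter> {-r'<..<r'}) (\<lambda>x. upper x - (1 + L) * K * (1 + L\<^sup>2) * x\<^sup>2)"
  unfolding concave_on_iff
proof (intro conjI ballI allI impI)
  show "convex (D \<inter> {-r'<..<r'})"
    by (intro convex_Int convex_D convex_real_interval)
  fix x y u v :: real
  assume xy: "x \<in> D \<inter> {-r'<..<r'}" "y \<in> D \<inter> {-r'<..<r'}" and uv: "0 \<le> u" "0 \<le> v" "u + v = 1"
  \<comment> \<open>The shrinking puts the graph points, and hence \<open>m\<close>, within
    \<open>r / 4\<close> of the origin. Then \<open>w\<close> is within \<open>r / 2\<close> and
    inside the window where \<open>upper\<close> is controlled.\<close>
  have r'1: "0 < r'" "4 * ((1 + L) * r') = r"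
    using r_pos L_nonneg by (simp_all add: r' divide_simps)
  have "r' \<le> r" using r'1 mult_nonneg_nonneg[OF L_nonneg, of r'] by (simp add: algebra_simps)
  have x: "x \<in> D" "\<bar>x\<bar> < r'" and y: "y \<in> D" "\<bar>y\<bar> < r'" using xy by auto
  have xr: "\<bar>x\<bar> < r" and yr: "\<bar>y\<bar> < r" using x y \<open>r' \<le> r\<close> by auto
  define p where "p = (x, upper x)"
  define q where "q = (y, upper y)"
  define m where "m = u *\<^sub>R p + v *\<^sub>R q"
  have small: "norm (t, upper t) \<le> (1 + L) * r'" if "t \<in> D" "\<bar>t\<bar> < r'" for t
  proof -
    have "norm (t, upper t) \<le> \<bar>t\<bar> + L * \<bar>t\<bar>"
      using norm_Pair_le[of t "upper t"] abs_upper_le[of t] that \<open>r' \<le> r\<close> by linarith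
    also have "\<dots> = (1 + L) * \<bar>t\<bar>" by (simp add: algebra_simps)
    also have "\<dots> \<le> (1 + L) * r'" using that L_nonneg by (intro mult_left_mono) auto
    finally show ?thesis .
  qed
  have "norm m \<le> u * norm p + v * norm q"
    unfolding m_def using norm_triangle_ineq[of "u *\<^sub>R p" "v *\<^sub>R q"] uv by simp
  also have "\<dots> \<le> u * ((1 + L) * r') + v * ((1 + L) * r')"
    unfolding p_def q_def using small x y uv by (intro add_mono mult_left_mono) auto
  also have "\<dots> = (1 + L) * r'" using uv by (metis distrib_right mult_1)
  finally have nm: "norm m \<le> r / 4" using r'1 by simp
  have "p \<in> A" "q \<in> A" "norm p < \<delta>" "norm q < \<delta>"
    using upper_mem x(1) y(1) xr yr norm_window by (auto simp: p_def q_def)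
  then obtain w where w: "w \<in> A" "dist w m \<le> norm m" "dist w m \<le> K * (u * v * (dist p q)\<^sup>2)"
    using near_segment[of p q u v] uv unfolding m_def by blast
  have "norm w \<le> r / 2"
    using norm_triangle_ineq[of "w - m" m] w(2) nm by (simp add: dist_norm)
  then have wb: "\<bar>fst w\<bar> < r" "\<bar>snd w\<bar> \<le> \<delta> / 2" 
    using abs_fst_le[of w] abs_snd_le[of w] r_pos r_le by linarith+
  have mb: "\<bar>fst m\<bar> < r" using abs_fst_le[of m] nm r_pos by linarith
  have fm: "fst m = u *\<^sub>R x + v *\<^sub>R y" by (simp add: m_def p_def q_def)
  have mD: "fst m \<in> D"
    unfolding fm using convex_D x(1) y(1) uv by (rule convexD)
  have sm: "snd m = u * upper x + v * upper y" by (simp add: m_def p_def q_def)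
  have "snd w \<le> upper (fst m) + L * \<bar>fst w - fst m\<bar>"
    using upper_cone[OF mD mb wb(1), of "snd w"] w(1) wb(2) by simp
  moreover have "\<bar>fst w - fst m\<bar> \<le> dist w m" "\<bar>snd w - snd m\<bar> \<le> dist w m"
    using abs_fst_le[of "w - m"] abs_snd_le[of "w - m"] by (simp_all add: dist_norm)
  moreover from this have "L * \<bar>fst w - fst m\<bar> \<le> L * dist w m"
    using L_nonneg by (intro mult_left_mono)
  ultimately have "snd m - (1 + L) * dist w m \<le> upper (fst m)"
    by (simp add: algebra_simps)
  moreover have "(1 + L) * dist w m \<le> (1 + L) * (K * (u * v * ((1 + L\<^sup>2) * (x - y)\<^sup>2)))"
  proof -
    have "\<bar>upper x - upper y\<bar> \<le> L * \<bar>x - y\<bar>"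
      using lipschitz_onD[OF upper_lipschitz, of x y] x(1) y(1) xr yr
      by (auto simp: dist_real_def abs_less_iff)
    then have "(upper x - upper y)\<^sup>2 \<le> (L * \<bar>x - y\<bar>)\<^sup>2"
      by (metis abs_ge_zero power2_abs power_mono)
    then have "(dist p q)\<^sup>2 \<le> (1 + L\<^sup>2) * (x - y)\<^sup>2"
      by (simp add: p_def q_def dist_Pair_Pair dist_real_def power_mult_distrib algebra_simps)
    then have "K * (u * v * (dist p q)\<^sup>2) \<le> K * (u * v * ((1 + L\<^sup>2) * (x - y)\<^sup>2))"
      using K_nonneg uv by (intro mult_left_mono) auto
    then show ?thesis using w(3) L_nonneg by (intro mult_left_mono) auto
  qed
  \<comment> \<open>This identity turns the error term into the concavity defect of a
    quadratic.\<close>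
  moreover have "u * x\<^sup>2 + v * y\<^sup>2 - (u * x + v * y)\<^sup>2 = u * v * (x - y)\<^sup>2"
  proof -
    have v: "v = 1 - u" using uv by simp
    show ?thesis unfolding v by (simp add: power2_eq_square algebra_simps)
  qed
  then have "(1 + L) * (K * (u * v * ((1 + L\<^sup>2) * (x - y)\<^sup>2)))
     = (1 + L) * K * (1 + L\<^sup>2) * (u * x\<^sup>2 + v * y\<^sup>2 - (u * x + v * y)\<^sup>2)" by (simp add: mult_ac)
  ultimately have "u * upper x + v * upper y
      - (1 + L) * K * (1 + L\<^sup>2) * (u * x\<^sup>2 + v * y\<^sup>2 - (u * x + v * y)\<^sup>2) \<le> upper (u * x + v * y)"
    unfolding fm sm by simp
  then show "u * (upper x - (1 + L) * K * (1 + L\<^sup>2) * x\<^sup>2) + v * (upper y - (1 + L) * K * (1 + L\<^sup>2) * y\<^sup>2)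
    \<le> upper (u *\<^sub>R x + v *\<^sub>R y) - (1 + L) * K * (1 + L\<^sup>2) * (u *\<^sub>R x + v *\<^sub>R y)\<^sup>2"
    by (simp only: right_diff_distrib distrib_left real_scaleR_def) (simp add: mult_ac)
qed

lemma upper_semiconcave:
  assumes "r' \<le> r / (4 * (1 + L))" "C \<subseteq> D \<inter> {-r'<..<r'}" "convex C"
  shows "semiconcave_on C upper"
  unfolding semiconcave_on_def
proof
  define s where "s = r / (4 * (1 + L))"
  have "s \<le> r" using r_pos L_nonneg by (simp add: s_def field_simps)
  have C: "C \<subseteq> D \<inter> {-s<..<s}" using assms(1,2) by (auto simp: s_def)
  then have "C \<subseteq> D \<inter> {-r<..<r}" using \<open>s \<le> r\<close> by fastforce
  then show "continuous_on C upper"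
    using lipschitz_on_continuous_on[OF upper_lipschitz] continuous_on_subset by blast
  have "concave_on C (\<lambda>x. upper x - (1 + L) * K * (1 + L\<^sup>2) * x\<^sup>2)"
    using convex_on_subset[OF upper_concave[OF s_def, unfolded concave_on_def] C assms(3)]
    by (simp add: concave_on_def)
  moreover have "0 \<le> (1 + L) * K * (1 + L\<^sup>2)" using L_nonneg K_nonneg by simp
  ultimately show "\<exists>c\<ge>0. concave_on C (\<lambda>x. upper x - c / 2 * \<bar>x\<bar>\<^sup>2)"
    by (intro exI[of _ "2 * ((1 + L) * K * (1 + L\<^sup>2))"]) simp
qed

text \<open>The lower end of the sections is handled as the upper end for the mirror image. Only
  \<open>section_zero\<close> is not symmetric under the reflection, hence the extra
  hypothesis.\<close>

lemma reflect:
  assumes "\<And>y. (0, y) \<in> A \<Longrightarrow> \<bar>y\<bar> \<le> \<delta> / 2 \<Longrightarrow> 0 \<le> y"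
  shows "local_graph {p. (fst p, - snd p) \<in> A} D \<delta> L K r"
proof -
  let ?\<rho> = "\<lambda>p :: real \<times> real. (fst p, - snd p)"
  let ?B = "{p. ?\<rho> p \<in> A}"
  have norm_\<rho>: "norm (?\<rho> p) = norm p" for p by (simp add: norm_prod_def)
  have dist_\<rho>: "dist (?\<rho> p) (?\<rho> q) = dist p q" for p q
    by (simp add: dist_prod_def dist_real_def abs_minus_commute)
  show ?thesis
  proof
    have "?B = ?\<rho> -` A" by auto
    moreover have "closed (?\<rho> -` A)"
      by (rule closed_vimage[OF closed_A]) (intro continuous_intros)
    ultimately show "closed ?B" by simp
    show "0 \<in> ?B" using zero_A by (simp add: zero_prod_def)
    fix z assume z: "norm z < \<delta>" "z \<notin> ?B" "fst z \<in> D"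
    have flip: "(\<forall>q\<in>?B. norm q < \<delta> \<longrightarrow> P q) \<longleftrightarrow> (\<forall>q\<in>A. norm q < \<delta> \<longrightarrow> P (?\<rho> q))" for P
    proof (intro iffI ballI impI)
      fix q assume "\<forall>q\<in>?B. norm q < \<delta> \<longrightarrow> P q" "q \<in> A" "norm q < \<delta>"
      then show "P (?\<rho> q)" using norm_\<rho>[of q] by simp
    next
      fix q assume *: "\<forall>q\<in>A. norm q < \<delta> \<longrightarrow> P (?\<rho> q)" "q \<in> ?B" "norm q < \<delta>"
      then have "P (?\<rho> (?\<rho> q))" using norm_\<rho>[of q] by (metis mem_Collect_eq)
      then show "P q" by simp
    qed
    show "(\<forall>q\<in>?B. norm q < \<delta> \<longrightarrow> snd q < snd z + L * \<bar>fst q - fst z\<bar>) \<or>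
          (\<forall>q\<in>?B. norm q < \<delta> \<longrightarrow> snd z - L * \<bar>fst q - fst z\<bar> < snd q)"
      unfolding flip using cone_dichotomy[of "?\<rho> z"] z norm_\<rho>[of z] by fastforce
  next
    fix x assume "x \<in> D" "\<bar>x\<bar> < r"
    then obtain y where "(x, y) \<in> A" "\<bar>y\<bar> \<le> \<delta> / 2" using section_nonempty by blast
    then show "\<exists>y. (x, y) \<in> ?B \<and> \<bar>y\<bar> \<le> \<delta> / 2" by (intro exI[of _ "- y"]) auto
  next
    fix p q and u v :: real
    assume pq: "p \<in> ?B" "q \<in> ?B" "norm p < \<delta>" "norm q < \<delta>" and uv: "0 \<le> u" "0 \<le> v" "u + v = 1"
    define m where "m = u *\<^sub>R p + v *\<^sub>R q"
    have m: "u *\<^sub>R ?\<rho> p + v *\<^sub>R ?\<rho> q = ?\<rho> m" by (simp add: m_def)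
    obtain w where "w \<in> A" "dist w (?\<rho> m) \<le> norm (?\<rho> m)"
        "dist w (?\<rho> m) \<le> K * (u * v * (dist (?\<rho> p) (?\<rho> q))\<^sup>2)"
      using near_segment[of "?\<rho> p" "?\<rho> q" u v] pq uv norm_\<rho>[of p] norm_\<rho>[of q]
      unfolding m by auto
    moreover have "dist w (?\<rho> m) = dist (?\<rho> w) m" using dist_\<rho>[of "?\<rho> w" m] by simp
    ultimately show "\<exists>w\<in>?B. dist w (u *\<^sub>R p + v *\<^sub>R q) \<le> norm (u *\<^sub>R p + v *\<^sub>R q) \<and>
        dist w (u *\<^sub>R p + v *\<^sub>R q) \<le> K * (u * v * (dist p q)\<^sup>2)"
      unfolding m_def[symmetric] dist_\<rho> norm_\<rho> by (intro bexI[of _ "?\<rho> w"]) auto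
  next
    fix p assume "p \<in> ?B" "norm p < \<delta>"
    then show "fst p \<in> D" using fst_in_D[of "?\<rho> p"] norm_\<rho>[of p] by simp
  next
    fix y assume "(0, y) \<in> ?B" "\<bar>y\<bar> \<le> \<delta> / 2"
    then show "y \<le> 0" using assms[of "- y"] by simp
  qed (use r_pos r_le L_nonneg K_nonneg convex_D in auto)
qed

end

section \<open>From exterior balls and steep normals to local graphs\<close>

lemma nearest_norm_le:
  assumes "nearest A z w" "0 \<in> A"
  shows "dist z w \<le> norm z"
  using nearest_le[OF assms] by simp

text \<open>A point \<open>q\<close> far above \<open>z\<close> in the direction of the normal would
  enter the exterior ball at \<open>w\<close>. With rise \<open>t\<close> and horizontal offset
  \<open>x\<close>, steepness gives \<open>(z - w) \<bullet> (q - w) \<ge> d * (d - \<bar>x\<bar> +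
  c * t)\<close>, while the ball gives \<open>2 * R\<close> times this at most
  \<open>d * N\<^sup>2\<close>. The smallness of \<open>\<delta>\<close> yields
  \<open>N \<le> c * R\<close>, which makes the quadratic bound linear in \<open>N\<close>. The sign
  \<open>s\<close> covers normals pointing up and down.\<close>

lemma exterior_ball_cone:
  fixes A :: "(real \<times> real) set"
  assumes ext: "exterior_balls R A" and "0 \<in> A" "z \<notin> A" and w: "nearest A z w"
    and c: "0 < c" "c \<le> 1" "6 * \<delta> \<le> c * R" and s: "s = 1 \<or> s = -1"
    and steep: "c * dist z w \<le> s * (snd z - snd w)"
    and zq: "norm z < \<delta>" "q \<in> A" "norm q < \<delta>"
  shows "c * (s * (snd q - snd z)) < 3 * \<bar>fst q - fst z\<bar>"
proof (cases "s * (snd q - snd z) < 0")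
  case True
  then have "c * (s * (snd q - snd z)) < 0" using c(1) by (simp add: mult_pos_neg)
  then show ?thesis by (smt (verit) abs_ge_zero)
next
  case False
  define d where "d = norm (z - w)"
  define t where "t = s * (snd q - snd z)"
  define x where "x = fst q - fst z"
  define N where "N = d + \<bar>x\<bar> + t"
  have "t \<ge> 0" using False by (simp add: t_def)
  have at: "\<bar>snd q - snd z\<bar> = t" using s \<open>t \<ge> 0\<close> by (auto simp: t_def)
  have "w \<in> A" using w by (simp add: nearest_def)
  then have "d > 0" using assms(3) by (auto simp: d_def)
  have dz: "d \<le> norm z" using nearest_norm_le[OF w assms(2)] by (simp add: d_def dist_norm)
  have "0 < \<delta>" using zq(1) norm_ge_zero[of z] by linarith
  have "0 < R" using c \<open>0 < \<delta>\<close> by (smt (verit) zero_less_mult_pos)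
  have "c * R \<le> R" using c \<open>0 < R\<close> by simp
  have "\<bar>x\<bar> \<le> 2 * \<delta>" "t \<le> 2 * \<delta>"
    using abs_fst_le[of "q - z"] abs_snd_le[of "q - z"] norm_triangle_ineq4[of q z] zq at
    by (simp_all add: x_def)
  then have N: "0 < N" "N \<le> c * R"
    using \<open>d > 0\<close> \<open>t \<ge> 0\<close> dz zq c \<open>0 < \<delta>\<close> unfolding N_def by linarith+
  have "2 * R * ((z - w) \<bullet> (q - w)) \<le> d * (norm (q - w))\<^sup>2"
    using ext assms(3) w zq dz c \<open>c * R \<le> R\<close> \<open>0 < \<delta>\<close>
    unfolding exterior_balls_def d_def dist_norm by (smt (verit))
  also have "\<dots> \<le> d * N\<^sup>2"
  proof (intro mult_left_mono power_mono)
    have "norm (q - w) \<le> norm (q - z) + norm (z - w)"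
      using norm_triangle_ineq[of "q - z" "z - w"] by simp
    moreover have "norm (q - z) \<le> \<bar>x\<bar> + t"
      using norm_Pair_le[of "fst (q - z)" "snd (q - z)"] at
      unfolding prod.collapse by (simp add: x_def)
    ultimately show "norm (q - w) \<le> N" by (simp add: N_def d_def)
  qed (use \<open>d > 0\<close> in auto)
  also have "\<dots> \<le> d * (N * (c * R))"
    using N \<open>d > 0\<close> by (simp add: power2_eq_square)
  finally have 1: "2 * R * ((z - w) \<bullet> (q - w)) \<le> d * (N * (c * R))" .
  have "d * (d - \<bar>x\<bar> + c * t) \<le> (z - w) \<bullet> (q - w)"
  proof -
    have "(z - w) \<bullet> (q - w) = (z - w) \<bullet> (z - w) + (z - w) \<bullet> (q - z)"
      by (simp add: inner_diff_right algebra_simps)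
    also have "(z - w) \<bullet> (z - w) = d * d" by (simp add: d_def flip: power2_norm_eq_inner power2_eq_square)
    also have "(z - w) \<bullet> (q - z) = (fst z - fst w) * x + (snd z - snd w) * (snd q - snd z)"
      by (simp add: inner_prod_def x_def)
    also have "(snd z - snd w) * (snd q - snd z) = s * (snd z - snd w) * t"
      using s by (auto simp: t_def)
    finally have e: "(z - w) \<bullet> (q - w) = d * d + ((fst z - fst w) * x + s * (snd z - snd w) * t)" .
    have "\<bar>(fst z - fst w) * x\<bar> \<le> d * \<bar>x\<bar>"
      unfolding abs_mult using abs_fst_le[of "z - w"] by (intro mult_right_mono) (auto simp: d_def)
    moreover have "c * d * t \<le> s * (snd z - snd w) * t"
      using steep \<open>t \<ge> 0\<close> by (intro mult_right_mono) (auto simp: d_def dist_norm)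
    ultimately show ?thesis unfolding e by (simp add: algebra_simps)
  qed
  then have "2 * R * (d * (d - \<bar>x\<bar> + c * t)) \<le> 2 * R * ((z - w) \<bullet> (q - w))"
    using \<open>0 < R\<close> by (intro mult_left_mono) auto
  with 1 have "R * d * (2 * (d - \<bar>x\<bar> + c * t)) \<le> R * d * (N * c)"
    by (simp add: algebra_simps)
  then have 2: "2 * (d - \<bar>x\<bar> + c * t) \<le> N * c"
    using \<open>0 < R\<close> \<open>d > 0\<close> by (simp add: mult_le_cancel_left)
  have "c * d \<le> d" "c * \<bar>x\<bar> \<le> \<bar>x\<bar>"
    using c \<open>d > 0\<close> by (simp_all add: mult_left_le_one_le)
  then have "c * t < 3 * \<bar>x\<bar>"
    using 2 \<open>d > 0\<close> unfolding N_def by (simp only: distrib_right distrib_left right_diff_distrib mult.commute[of _ c])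
  then show ?thesis by (simp add: t_def x_def)
qed

text \<open>Steepness makes the normal at a missing point point clearly up or down, and this sign
  selects the branch of the cone dichotomy. Approximation of segments follows by taking nearest
  points, which are no farther away than the origin.\<close>

lemma exterior_balls_local_graph:
  assumes "closed A" "0 \<in> A" and ext: "exterior_balls R A" and "0 < R"
    and c: "0 < c" "c \<le> 1" "6 * \<delta> \<le> c * R" and r: "0 < r" "r \<le> \<delta> / 2" and "convex D"
    and steep: "\<And>z w. norm z < \<delta> \<Longrightarrow> z \<notin> A \<Longrightarrow> fst z \<in> D \<Longrightarrow> nearest A z w \<Longrightarrow>
       c * dist z w \<le> \<bar>snd z - snd w\<bar>"
    and sec: "\<And>x. x \<in> D \<Longrightarrow> \<bar>x\<bar> < r \<Longrightarrow> \<exists>y. (x, y) \<in> A \<and> \<bar>y\<bar> \<le> \<delta> / 2"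
    and inD: "\<And>p. p \<in> A \<Longrightarrow> norm p < \<delta> \<Longrightarrow> fst p \<in> D"
    and sec0: "\<And>y. (0, y) \<in> A \<Longrightarrow> \<bar>y\<bar> \<le> \<delta> / 2 \<Longrightarrow> y \<le> 0"
  shows "local_graph A D \<delta> (3 / c) (1 / R) r"
proof
  fix z assume z: "norm z < \<delta>" "z \<notin> A" "fst z \<in> D"
  obtain w where w: "nearest A z w" using nearest_exists assms(1,2) by blast
  have st: "c * dist z w \<le> \<bar>snd z - snd w\<bar>" using steep z w by blast
  define s :: real where "s = (if snd z \<ge> snd w then 1 else -1)"
  have s: "s = 1 \<or> s = -1" "\<bar>snd z - snd w\<bar> = s * (snd z - snd w)" by (auto simp: s_def)
  have cone: "c * (s * (snd q - snd z)) < 3 * \<bar>fst q - fst z\<bar>" if "q \<in> A" "norm q < \<delta>" for q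
    using exterior_ball_cone[OF ext assms(2) z(2) w c s(1) _ z(1) that] st s(2) by simp
  from s(1) show "(\<forall>q\<in>A. norm q < \<delta> \<longrightarrow> snd q < snd z + 3 / c * \<bar>fst q - fst z\<bar>) \<or>
     (\<forall>q\<in>A. norm q < \<delta> \<longrightarrow> snd z - 3 / c * \<bar>fst q - fst z\<bar> < snd q)"
  proof
    assume "s = 1"
    then have "snd q < snd z + 3 / c * \<bar>fst q - fst z\<bar>" if "q \<in> A" "norm q < \<delta>" for q
      using cone[OF that] c(1) by (simp add: field_simps)
    then show ?thesis by blast
  next
    assume "s = -1"
    then have "snd z - 3 / c * \<bar>fst q - fst z\<bar> < snd q" if "q \<in> A" "norm q < \<delta>" for q
      using cone[OF that] c(1) by (simp add: field_simps)
    then show ?thesis by blast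
  qed
next
  fix p q and u v :: real
  assume pq: "p \<in> A" "q \<in> A" "norm p < \<delta>" "norm q < \<delta>" and uv: "0 \<le> u" "0 \<le> v" "u + v = 1"
  let ?m = "u *\<^sub>R p + v *\<^sub>R q"
  obtain w where w: "nearest A ?m w" using nearest_exists assms(1,2) by blast
  have "?m \<in> ball 0 \<delta>" using pq uv by (intro convexD[OF convex_ball]) auto
  moreover have "\<delta> \<le> R"
  proof -
    have "c * R \<le> R" using c assms(4) by simp
    then show ?thesis using c(3) r by linarith
  qed
  ultimately have d: "dist ?m w \<le> norm ?m" "dist ?m w < R"
    using nearest_norm_le[OF w assms(2)] by auto
  have "dist ?m w \<le> 1 / R * (u * v * (dist p q)\<^sup>2)"
    using exterior_balls_near_segment[OF ext assms(4) pq(1,2) uv w d(2)] by simp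
  then show "\<exists>w\<in>A. dist w ?m \<le> norm ?m \<and> dist w ?m \<le> 1 / R * (u * v * (dist p q)\<^sup>2)"
    using d(1) w by (intro bexI[of _ w]) (auto simp: dist_commute nearest_def)
qed (use assms in auto)

text \<open>All normals point upwards here, so only the upward cones occur and everything below the
  graph belongs to \<open>A\<close>.\<close>

lemma vertical_normals_imp_T1:
  assumes "closed A" "0 \<in> A" "0 \<notin> interior A" and ext: "exterior_balls R A" and "0 < R"
    and c: "0 < c" "c \<le> 1" and "0 < \<delta>\<^sub>0"
    and steep: "\<And>z w. norm z < \<delta>\<^sub>0 \<Longrightarrow> z \<notin> A \<Longrightarrow> nearest A z w \<Longrightarrow> c * dist z w \<le> snd z - snd w"
  shows "\<exists>r>0. T1_tilde r (A \<inter> ball 0 r)"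
proof -
  define \<delta> where "\<delta> = min \<delta>\<^sub>0 (c * R / 6)"
  define L where "L = 3 / c"
  define r where "r = \<delta> / (2 * (1 + L))"
  have "0 < L" using c by (simp add: L_def)
  have "0 < \<delta>" using assms(5,8) c by (simp add: \<delta>_def)
  have r: "0 < r" "2 * ((1 + L) * r) = \<delta>"
    using \<open>0 < \<delta>\<close> \<open>0 < L\<close> by (simp_all add: r_def divide_simps)
  have "r + L * r = \<delta> / 2" using r(2) by (simp add: algebra_simps)
  moreover have "0 < L * r" using \<open>0 < L\<close> r(1) by simp
  ultimately have rL: "r < \<delta> / 2" "L * r < \<delta> / 2" using r(1) by linarith+
  have below: "snd q < snd z + L * \<bar>fst q - fst z\<bar>"
    if "norm z < \<delta>" "z \<notin> A" "q \<in> A" "norm q < \<delta>" for z q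
  proof -
    obtain w where w: "nearest A z w" using nearest_exists assms(1,2) by blast
    have "c * dist z w \<le> 1 * (snd z - snd w)" using steep[OF _ that(2) w] that(1) by (simp add: \<delta>_def)
    then have "c * (1 * (snd q - snd z)) < 3 * \<bar>fst q - fst z\<bar>"
      by (intro exterior_ball_cone[OF ext assms(2) that(2) w c _ _ _ that(1,3,4)]) (auto simp: \<delta>_def)
    then show ?thesis using c by (simp add: L_def field_simps)
  qed
  have "local_graph A UNIV \<delta> (3 / c) (1 / R) r"
  proof (rule exterior_balls_local_graph[OF assms(1,2) ext assms(5) c])
    show "c * dist z w \<le> \<bar>snd z - snd w\<bar>" if "norm z < \<delta>" "z \<notin> A" "nearest A z w" for z w
      using steep[of z w] that by (simp add: \<delta>_def)
    show "\<exists>y. (x, y) \<in> A \<and> \<bar>y\<bar> \<le> \<delta> / 2" if "\<bar>x\<bar> < r" for x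
    proof (intro exI conjI)
      have Lx: "\<bar>L * \<bar>x\<bar>\<bar> \<le> L * r" using that \<open>0 < L\<close> by (simp add: abs_mult)
      then show "\<bar>- (L * \<bar>x\<bar>)\<bar> \<le> \<delta> / 2" using rL by simp
      \<comment> \<open>If this point were missing, the origin would be strictly below its upward
        cone, but the origin lies on the boundary of that cone.\<close>
      show "(x, - (L * \<bar>x\<bar>)) \<in> A"
      proof (rule ccontr)
        assume "(x, - (L * \<bar>x\<bar>)) \<notin> A"
        moreover have "norm (x, - (L * \<bar>x\<bar>)) < \<delta>"
          using norm_Pair_le[of x "- (L * \<bar>x\<bar>)"] Lx that rL by simp
        ultimately show False using below[of "(x, - (L * \<bar>x\<bar>))" 0] assms(2) \<open>0 < \<delta>\<close> by simp
      qed
    qed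
    show "y \<le> 0" if y: "(0, y) \<in> A" "\<bar>y\<bar> \<le> \<delta> / 2" for y
    proof (rule ccontr)
      assume "\<not> y \<le> 0"
      \<comment> \<open>Since the origin is not interior there are missing points \<open>z\<close>
        arbitrarily close to it; the upward cone at such a point passes over the origin at height at
        most \<open>(1 + L) * norm z\<close>, which is below \<open>y\<close>.\<close>
      define \<eta> where "\<eta> = min \<delta> (y / (1 + L))"
      have "\<eta> > 0" using \<open>\<not> y \<le> 0\<close> \<open>0 < \<delta>\<close> \<open>0 < L\<close> by (simp add: \<eta>_def)
      then obtain z where z: "norm z < \<eta>" "z \<notin> A"
        using assms(3) by (auto simp: mem_interior subset_iff)
      have "norm (0, y) < \<delta>" using y(2) \<open>0 < \<delta>\<close> by (simp add: norm_Pair)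
      then have "y < snd z + L * \<bar>fst z\<bar>"
        using below[of z "(0, y)"] z y(1) by (simp add: \<eta>_def)
      also have "\<dots> \<le> (1 + L) * norm z"
        using abs_snd_le[of z] mult_left_mono[OF abs_fst_le[of z] less_imp_le[OF \<open>0 < L\<close>]]
        by (simp only: distrib_right)
      also have "\<dots> \<le> (1 + L) * (y / (1 + L))"
        using z(1) \<open>0 < L\<close> by (intro mult_left_mono) (auto simp: \<eta>_def)
      finally show False using \<open>0 < L\<close> by (simp split: if_splits)
    qed
  qed (use r rL in \<open>auto simp: \<delta>_def\<close>)
  then interpret local_graph A UNIV \<delta> L "1 / R" r by (simp add: L_def)
  define r' where "r' = r / (4 * (1 + L))"
  have r': "0 < r'" "r' \<le> r" using r(1) \<open>0 < L\<close> by (simp_all add: r'_def divide_simps)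
  have "T1_tilde r' (A \<inter> ball 0 r')"
    unfolding T1_tilde_def
  proof (intro exI conjI)
    show "is_lipschitz_on {-r'<..<r'} upper"
      unfolding is_lipschitz_on_def using r'(2)
      by (intro exI[of _ L] lipschitz_on_subset[OF upper_lipschitz]) auto
    show "semiconcave_on {-r'<..<r'} upper"
      by (rule upper_semiconcave[of r']) (auto simp: r'_def)
    show "upper 0 = 0" by (rule upper_zero)
    show "A \<inter> ball 0 r' = ball 0 r' \<inter> hypo {-r'<..<r'} upper"
    proof (intro set_eqI iffI)
      fix p assume p: "p \<in> A \<inter> ball 0 r'"
      then have "norm p < r'" by simp
      then have "\<bar>fst p\<bar> < r'" "\<bar>snd p\<bar> \<le> \<delta> / 2"
        using abs_fst_le[of p] abs_snd_le[of p] rL r' by linarith+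
      then show "p \<in> ball 0 r' \<inter> hypo {-r'<..<r'} upper"
        using p le_upper[of "fst p" "snd p"] by (cases p) (auto simp: hypo_def)
    next
      fix p assume "p \<in> ball 0 r' \<inter> hypo {-r'<..<r'} upper"
      then obtain x y where p: "p = (x, y)" "norm p < r'" "\<bar>x\<bar> < r'" "y \<le> upper x"
        by (cases p) (auto simp: hypo_def)
      have "\<bar>x\<bar> < r" using p(3) r'(2) by simp
      note u = upper_mem[OF UNIV_I this]
      \<comment> \<open>If \<open>p\<close> were missing, \<open>below\<close> would put
        \<open>(x, upper x)\<close> strictly under it.\<close>
      have "p \<in> A"
        using below[of p "(x, upper x)"] p u norm_window[OF \<open>\<bar>x\<bar> < r\<close> u(2)] rL r' by force
      then show "p \<in> A \<inter> ball 0 r'" using p(2) by simp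
    qed
  qed
  then show ?thesis using r'(1) by blast
qed

text \<open>At the end of a gap in the projection of \<open>A\<close> to the horizontal axis there would be a horizontal
  normal, contradicting the steepness assumption.\<close>

lemma sections_nonempty:
  fixes A :: "(real \<times> real) set"
  assumes "closed A" "0 \<in> A" and s: "s = 1 \<or> s = -1" and "0 < c"
    and steep: "\<And>z w. norm z < \<delta> \<Longrightarrow> z \<notin> A \<Longrightarrow> 0 \<le> s * fst z \<Longrightarrow> nearest A z w \<Longrightarrow>
       c * dist z w \<le> \<bar>snd z - snd w\<bar>"
    and flat: "\<And>p. p \<in> A \<Longrightarrow> norm p < \<delta> \<Longrightarrow> \<bar>snd p\<bar> \<le> \<bar>fst p\<bar>"
    and x: "0 \<le> x\<^sub>0" "x\<^sub>0 < \<delta> / 8"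
  shows "\<exists>y. (s * x\<^sub>0, y) \<in> A \<and> \<bar>y\<bar> \<le> x\<^sub>0"
proof -
  define S where "S = A \<inter> {p. 0 \<le> s * fst p} \<inter> {p. s * fst p \<le> x\<^sub>0} \<inter> {p. \<bar>snd p\<bar> \<le> s * fst p}"
  have "closed S"
    unfolding S_def by (intro closed_Int assms(1) closed_Collect_le continuous_intros)
  moreover have "bounded S"
  proof (rule boundedI)
    fix p assume "p \<in> S"
    then have "\<bar>fst p\<bar> \<le> x\<^sub>0" "\<bar>snd p\<bar> \<le> x\<^sub>0" using s by (auto simp: S_def)
    then show "norm p \<le> 2 * x\<^sub>0" using norm_Pair_le[of "fst p" "snd p"] by simp
  qed
  ultimately have "compact ((\<lambda>p. s * fst p) ` S)"
    by (intro compact_continuous_image continuous_intros) (simp add: compact_eq_bounded_closed)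
  moreover have "0 \<in> S" using assms(2) x by (simp add: S_def)
  ultimately obtain p where p: "p \<in> S" "\<And>q. q \<in> S \<Longrightarrow> s * fst q \<le> s * fst p"
    using compact_attains_sup[of "(\<lambda>p. s * fst p) ` S"] by blast
  define a where "a = s * fst p"
  have ss: "s * s = 1" using s by auto
  then have fp: "fst p = s * a" by (simp add: a_def mult.assoc[symmetric])
  have a: "0 \<le> a" "a \<le> x\<^sub>0" "\<bar>snd p\<bar> \<le> a" "p \<in> A" using p(1) by (auto simp: S_def a_def)
  have "a = x\<^sub>0"
  proof (rule ccontr)
    assume "a \<noteq> x\<^sub>0"
    \<comment> \<open>A third of the gap: the nearest point of \<open>z\<close> is within
      \<open>h\<close>, so its abscissa still falls short of \<open>x\<^sub>0\<close> and maximality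
      of \<open>p\<close> applies to it.\<close>
    define h where "h = (x\<^sub>0 - a) / 3"
    have h: "0 < h" "a + 3 * h = x\<^sub>0" using a \<open>a \<noteq> x\<^sub>0\<close> by (auto simp: h_def field_simps)
    define z where "z = (s * (a + h), snd p)"
    have sz: "s * fst z = a + h" using ss by (simp add: z_def mult.assoc[symmetric])
    have "\<bar>s * (a + h)\<bar> = a + h" using s a(1) h(1) by auto
    then have nz: "norm z \<le> 2 * x\<^sub>0"
      using norm_Pair_le[of "s * (a + h)" "snd p"] a h unfolding z_def by linarith
    have notS: "s * fst q \<le> a" if "q \<in> A" "norm q < \<delta>" "s * fst q \<le> x\<^sub>0" for q
    proof (cases "0 \<le> s * fst q")
      case True
      then have "s * fst q = \<bar>fst q\<bar>" using s by auto
      then have "q \<in> S" using that flat[OF that(1,2)] by (simp add: S_def)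
      then show ?thesis using p(2) by (simp add: a_def)
    qed (use a in linarith)
    have "z \<notin> A" using notS[of z] sz nz x h by auto
    obtain w where w: "nearest A z w" using nearest_exists assms(1,2) by blast
    then have "w \<in> A" by (simp add: nearest_def)
    have "dist z p = h"
    proof -
      have "z - p = (s * h, 0)" using fp by (cases p) (simp add: z_def algebra_simps)
      then show ?thesis using s h by (auto simp: dist_norm norm_Pair)
    qed
    then have dw: "dist z w \<le> h" using nearest_le[OF w a(4)] by simp
    have f: "\<bar>fst z - fst w\<bar> \<le> dist z w" using abs_fst_le[of "z - w"] by (simp add: dist_norm)
    have "\<bar>s * fst z - s * fst w\<bar> = \<bar>fst z - fst w\<bar>"
      using s by auto
    then have "s * fst w \<le> x\<^sub>0" using f dw sz h by linarith
    moreover have "norm w < \<delta>"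
      using norm_triangle_ineq4[of z "z - w"] dw nz x h a by (simp add: dist_norm)
    ultimately have "s * fst w \<le> a" using notS \<open>w \<in> A\<close> by blast
    then have "h \<le> \<bar>fst z - fst w\<bar>" using sz \<open>\<bar>s * fst z - s * fst w\<bar> = _\<close> by linarith
    \<comment> \<open>The horizontal offset already uses up the whole distance, so the normal at
      \<open>w\<close> is horizontal.\<close>
    then have "(dist z w)\<^sup>2 \<le> (fst z - fst w)\<^sup>2"
      using dw by (metis abs_le_square_iff abs_of_nonneg order_trans zero_le_dist)
    then have "snd z = snd w"
      by (simp add: dist_prod_def dist_real_def)
    then have "c * dist z w \<le> 0"
      using steep[OF _ \<open>z \<notin> A\<close> _ w] nz x sz a h by simp
    then have "z = w" using \<open>0 < c\<close> by (simp add: mult_le_0_iff)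
    then show False using \<open>w \<in> A\<close> \<open>z \<notin> A\<close> by simp
  qed
  then show ?thesis using a fp by (intro exI[of _ "snd p"]) (metis prod.collapse)
qed

section \<open>Graphs over a horizontal tangent\<close>

definition flat_at_zero :: "(real \<times> real) set \<Rightarrow> bool" where
  "flat_at_zero A \<longleftrightarrow> (\<forall>\<epsilon>>0. \<exists>\<eta>>0. \<forall>p\<in>A. norm p < \<eta> \<longrightarrow> \<bar>snd p\<bar> \<le> \<epsilon> * \<bar>fst p\<bar>)"

text \<open>The linear bound on \<open>f\<close> sends graph points into the small ball where
  flatness applies; flatness there bounds the difference quotient.\<close>

lemma flat_at_zero_derivative:
  assumes "flat_at_zero A" "0 < r" "0 \<le> L" "f 0 = 0"
    and f: "\<And>x. x \<in> D \<Longrightarrow> \<bar>x\<bar> < r \<Longrightarrow> (x, f x) \<in> A \<and> \<bar>f x\<bar> \<le> L * \<bar>x\<bar>"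
  shows "(f has_real_derivative 0) (at 0 within D)"
  unfolding has_field_derivative_iff
proof (rule tendstoI)
  fix e :: real assume "0 < e"
  then obtain \<eta> where \<eta>: "0 < \<eta>" "\<And>p. p \<in> A \<Longrightarrow> norm p < \<eta> \<Longrightarrow> \<bar>snd p\<bar> \<le> e / 2 * \<bar>fst p\<bar>"
    using assms(1) unfolding flat_at_zero_def by (metis half_gt_zero)
  have "dist ((f x - f 0) / (x - 0)) 0 < e"
    if x: "x \<in> D" "x \<noteq> 0" "dist x 0 < min r (\<eta> / (1 + L))" for x
  proof -
    have fx: "(x, f x) \<in> A" "\<bar>f x\<bar> \<le> L * \<bar>x\<bar>" using f[of x] x by auto
    have "norm (x, f x) \<le> (1 + L) * \<bar>x\<bar>"
      using norm_Pair_le[of x "f x"] fx(2) by (simp add: algebra_simps)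
    also have "\<dots> < \<eta>" using x(3) assms(3) by (simp add: field_simps)
    finally have "\<bar>f x\<bar> \<le> e / 2 * \<bar>x\<bar>" using \<eta>(2)[OF fx(1)] by simp
    then have "\<bar>f x\<bar> / \<bar>x\<bar> \<le> e / 2" using x(2) by (simp add: divide_simps)
    then have "\<bar>f x\<bar> / \<bar>x\<bar> < e" using \<open>0 < e\<close> by linarith
    then show ?thesis using assms(4) by (simp add: dist_real_def)
  qed
  moreover have "0 < min r (\<eta> / (1 + L))" using assms(2,3) \<eta>(1) by simp
  ultimately show "\<forall>\<^sub>F x in at 0 within D. dist ((f x - f 0) / (x - 0)) 0 < e"
    unfolding eventually_at by blast
qed

text \<open>Types 2 and 3 are treated together, with \<open>D\<close> the line or the half line. The
  upper function comes from \<open>A\<close> and the lower one from its mirror image; flatness makes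
  the section over 0 a single point, so the reflection is permitted and both functions vanish at
  0.\<close>

lemma flat_at_zero_graphs:
  assumes "closed A" "0 \<in> A" and ext: "exterior_balls R A" and "0 < R"
    and D: "D = UNIV \<or> D = {0..}" and "0 < \<delta>\<^sub>0" and flat: "flat_at_zero A"
    and steep: "\<And>z w. norm z < \<delta>\<^sub>0 \<Longrightarrow> z \<notin> A \<Longrightarrow> fst z \<in> D \<Longrightarrow> nearest A z w \<Longrightarrow>
       1 / 2 * dist z w \<le> \<bar>snd z - snd w\<bar>"
    and inD: "\<And>p. p \<in> A \<Longrightarrow> norm p < \<delta>\<^sub>0 \<Longrightarrow> fst p \<in> D"
  obtains r \<phi> \<psi> where "0 < r" "is_lipschitz_on (D \<inter> {-r<..<r}) \<phi>" "is_lipschitz_on (D \<inter> {-r<..<r}) \<psi>"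
    "\<forall>x\<in>D \<inter> {-r<..<r}. \<psi> x \<le> \<phi> x"
    "\<And>C. convex C \<Longrightarrow> C \<subseteq> D \<inter> {-r<..<r} \<Longrightarrow> semiconcave_on C \<phi>"
    "\<And>C. convex C \<Longrightarrow> C \<subseteq> D \<inter> {-r<..<r} \<Longrightarrow> semiconvex_on C \<psi>"
    "\<phi> 0 = 0" "\<psi> 0 = 0" "(\<phi> has_real_derivative 0) (at 0 within D)"
    "(\<psi> has_real_derivative 0) (at 0 within D)"
    "A \<inter> ball 0 r = ball 0 r \<inter> hypo (D \<inter> {-r<..<r}) \<phi> \<inter> epi (D \<inter> {-r<..<r}) \<psi>"
proof -
  obtain \<eta> where \<eta>: "0 < \<eta>" "\<And>p. p \<in> A \<Longrightarrow> norm p < \<eta> \<Longrightarrow> \<bar>snd p\<bar> \<le> \<bar>fst p\<bar>"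
    using flat unfolding flat_at_zero_def by (metis mult_1 zero_less_one)
  \<comment> \<open>\<open>R / 12\<close> is \<open>c * R / 6\<close> for \<open>c = 1/2\<close>;
    the Lipschitz constant \<open>3 / c\<close> is then 6.\<close>
  define \<delta> where "\<delta> = min (min \<delta>\<^sub>0 \<eta>) (R / 12)"
  have "0 < \<delta>" using assms(4,6) \<eta>(1) by (simp add: \<delta>_def)
  have sec0: "y = 0" if "(0, y) \<in> A" "\<bar>y\<bar> \<le> \<delta> / 2" for y
  proof -
    have "norm (0, y) < \<delta>" using that(2) \<open>0 < \<delta>\<close> by (simp add: norm_Pair)
    then show ?thesis using \<eta>(2)[OF that(1)] by (simp add: \<delta>_def)
  qed
  have sec: "\<exists>y. (x, y) \<in> A \<and> \<bar>y\<bar> \<le> \<delta> / 2" if x: "x \<in> D" "\<bar>x\<bar> < \<delta> / 8" for x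
  proof -
    define s :: real where "s = (if 0 \<le> x then 1 else -1)"
    have s: "s = 1 \<or> s = -1" "s * \<bar>x\<bar> = x" by (auto simp: s_def)
    have "fst z \<in> D" if "0 \<le> s * fst z" for z :: "real \<times> real"
      using that D x(1) by (auto simp: s_def split: if_splits)
    then have "\<exists>y. (s * \<bar>x\<bar>, y) \<in> A \<and> \<bar>y\<bar> \<le> \<bar>x\<bar>"
      using steep \<eta>(2) x(2)
      by (intro sections_nonempty[OF assms(1,2) s(1), of "1/2" \<delta>]) (auto simp: \<delta>_def)
    then show ?thesis using s(2) x(2) by force
  qed
  have "local_graph A D \<delta> (3 / (1/2)) (1 / R) (\<delta> / 8)"
  proof (rule exterior_balls_local_graph[OF assms(1,2) ext assms(4)])
    show "convex D" using D by (auto simp: convex_real_interval)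
    show "1/2 * dist z w \<le> \<bar>snd z - snd w\<bar>" if "norm z < \<delta>" "z \<notin> A" "fst z \<in> D" "nearest A z w" for z w
      using steep that by (simp add: \<delta>_def)
    show "fst p \<in> D" if "p \<in> A" "norm p < \<delta>" for p
      using inD that by (simp add: \<delta>_def)
    show "y \<le> 0" if "(0, y) \<in> A" "\<bar>y\<bar> \<le> \<delta> / 2" for y
      using sec0[OF that] by simp
    show "\<exists>y. (x, y) \<in> A \<and> \<bar>y\<bar> \<le> \<delta> / 2" if "x \<in> D" "\<bar>x\<bar> < \<delta> / 8" for x
      using sec that .
  qed (use \<open>0 < \<delta>\<close> in \<open>auto simp: \<delta>_def\<close>)
  then interpret U: local_graph A D \<delta> 6 "1 / R" "\<delta> / 8" by simp
  interpret W: local_graph "{p. (fst p, - snd p) \<in> A}" D \<delta> 6 "1 / R" "\<delta> / 8"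
    by (rule U.reflect) (use sec0 in force)
  define \<phi> where "\<phi> = U.upper"
  define \<psi> where "\<psi> x = - W.upper x" for x
  \<comment> \<open>The shrinking factor required by \<open>upper_semiconcave\<close> for
    \<open>L = 6\<close>.\<close>
  define r where "r = \<delta> / 8 / (4 * (1 + 6))"
  have r: "0 < r" "r \<le> \<delta> / 8" using \<open>0 < \<delta>\<close> by (simp_all add: r_def)
  have sub: "D \<inter> {-r<..<r} \<subseteq> D \<inter> {-(\<delta>/8)<..<\<delta>/8}" using r(2) by auto
  have \<phi>: "(x, \<phi> x) \<in> A" "\<bar>\<phi> x\<bar> \<le> \<delta> / 2" "\<bar>\<phi> x\<bar> \<le> 6 * \<bar>x\<bar>" if "x \<in> D" "\<bar>x\<bar> < r" for x
    using U.upper_mem[of x] U.abs_upper_le[of x] that r(2) by (auto simp: \<phi>_def)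
  have \<psi>: "(x, \<psi> x) \<in> A" "\<bar>\<psi> x\<bar> \<le> \<delta> / 2" "\<bar>\<psi> x\<bar> \<le> 6 * \<bar>x\<bar>" if "x \<in> D" "\<bar>x\<bar> < r" for x
    using W.upper_mem[of x] W.abs_upper_le[of x] that r(2) by (auto simp: \<psi>_def)
  have z: "\<phi> 0 = 0" "\<psi> 0 = 0" using U.upper_zero W.upper_zero by (simp_all add: \<phi>_def \<psi>_def)
  show thesis
  proof (rule that[of r \<phi> \<psi>])
    show "is_lipschitz_on (D \<inter> {-r<..<r}) \<phi>"
      unfolding is_lipschitz_on_def \<phi>_def using lipschitz_on_subset[OF U.upper_lipschitz sub] by blast
    show "is_lipschitz_on (D \<inter> {-r<..<r}) \<psi>"
      unfolding is_lipschitz_on_def \<psi>_def lipschitz_on_minus_iff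
      using lipschitz_on_subset[OF W.upper_lipschitz sub] by blast
    show "\<forall>x\<in>D \<inter> {-r<..<r}. \<psi> x \<le> \<phi> x"
    proof
      fix x assume "x \<in> D \<inter> {-r<..<r}"
      then have "x \<in> D" "\<bar>x\<bar> < r" by auto
      then show "\<psi> x \<le> \<phi> x" using U.le_upper[of x "\<psi> x"] \<psi> by (simp add: \<phi>_def)
    qed
    show "semiconcave_on C \<phi>" if "convex C" "C \<subseteq> D \<inter> {-r<..<r}" for C
      unfolding \<phi>_def using that by (intro U.upper_semiconcave[of r]) (auto simp: r_def)
    show "semiconvex_on C \<psi>" if "convex C" "C \<subseteq> D \<inter> {-r<..<r}" for C
      unfolding \<psi>_def semiconvex_on_def minus_minus
      using that by (intro W.upper_semiconcave[of r]) (auto simp: r_def)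
    show "(\<phi> has_real_derivative 0) (at 0 within D)"
      using \<phi> z r by (intro flat_at_zero_derivative[OF flat, of r 6]) auto
    show "(\<psi> has_real_derivative 0) (at 0 within D)"
      using \<psi> z r by (intro flat_at_zero_derivative[OF flat, of r 6]) auto
    show "A \<inter> ball 0 r = ball 0 r \<inter> hypo (D \<inter> {-r<..<r}) \<phi> \<inter> epi (D \<inter> {-r<..<r}) \<psi>"
    proof (intro set_eqI iffI)
      fix p assume p: "p \<in> A \<inter> ball 0 r"
      then have "norm p < r" by simp
      then have b: "\<bar>fst p\<bar> < r" "\<bar>snd p\<bar> \<le> \<delta> / 2" "norm p < \<delta>"
        using abs_fst_le[of p] abs_snd_le[of p] r by linarith+
      have "fst p \<in> D" using U.fst_in_D p b(3) by blast
      moreover have "snd p \<le> \<phi> (fst p)" "\<psi> (fst p) \<le> snd p"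
        using U.le_upper[of "fst p" "snd p"] W.le_upper[of "fst p" "- snd p"] p b(2)
        by (auto simp: \<phi>_def \<psi>_def)
      ultimately show "p \<in> ball 0 r \<inter> hypo (D \<inter> {-r<..<r}) \<phi> \<inter> epi (D \<inter> {-r<..<r}) \<psi>"
        using p b(1) by (cases p) (auto simp: hypo_def epi_def)
    next
      fix p assume "p \<in> ball 0 r \<inter> hypo (D \<inter> {-r<..<r}) \<phi> \<inter> epi (D \<inter> {-r<..<r}) \<psi>"
      then obtain x y where p: "p = (x, y)" "norm p < r" "x \<in> D" "\<bar>x\<bar> < r" "\<psi> x \<le> y" "y \<le> \<phi> x"
        by (cases p) (auto simp: hypo_def epi_def)
      then have "p \<in> A"
        using U.vertically_convex[of x "\<psi> x" "\<phi> x" y] \<phi>[of x] \<psi>[of x] r(2) by simp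
      then show "p \<in> A \<inter> ball 0 r" using p(2) by simp
    qed
  qed (use r z in auto)
qed

section \<open>Tangent directions\<close>

text \<open>The limits of secant directions, that is, the unit vectors of the Bouligand contingent
  cone.\<close>

definition tangent_dir :: "'a::real_normed_vector set \<Rightarrow> 'a \<Rightarrow> 'a \<Rightarrow> bool" where
  "tangent_dir A a u \<longleftrightarrow> norm u = 1 \<and>
     (\<forall>\<epsilon>>0. \<exists>p\<in>A. p \<noteq> a \<and> norm (p - a) < \<epsilon> \<and> norm (sgn (p - a) - u) < \<epsilon>)"

text \<open>Otherwise points of \<open>A\<close> converge to \<open>a\<close> with secant directions
  in \<open>K\<close>. By compactness of the sphere these directions accumulate at a unit vector,
  which is a tangent direction and lies in the closed set \<open>K\<close>.\<close>

lemma tangent_dir_avoids_closed: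
  fixes A :: "'a::euclidean_space set"
  assumes "closed K" and no: "\<And>u. u \<in> K \<Longrightarrow> \<not> tangent_dir A a u"
  shows "\<exists>\<eta>>0. \<forall>p\<in>A. p \<noteq> a \<longrightarrow> norm (p - a) < \<eta> \<longrightarrow> sgn (p - a) \<notin> K"
proof (rule ccontr)
  assume "\<not> ?thesis"
  then have neg: "\<exists>p\<in>A. p \<noteq> a \<and> norm (p - a) < \<eta> \<and> sgn (p - a) \<in> K" if "\<eta> > 0" for \<eta>
    using that by blast
  have "\<exists>p\<in>A. p \<noteq> a \<and> norm (p - a) < inverse (real (Suc n)) \<and> sgn (p - a) \<in> K" for n
    by (rule neg) simp
  then obtain p where p: "\<And>n. p n \<in> A" "\<And>n. p n \<noteq> a"
      "\<And>n. norm (p n - a) < inverse (real (Suc n))" "\<And>n. sgn (p n - a) \<in> K"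
    by metis
  have "sgn (p n - a) \<in> sphere 0 1" for n using p(2)[of n] by (simp add: norm_sgn)
  then obtain u k where u: "u \<in> sphere 0 1" "strict_mono (k :: nat \<Rightarrow> nat)"
      "((\<lambda>n. sgn (p n - a)) \<circ> k) \<longlonglongrightarrow> u"
    using compact_sphere[of "0 :: 'a" 1] unfolding compact_def by metis
  have "u \<in> K"
    using closed_sequentially[OF assms(1) _ u(3)] p(4) by simp
  moreover have "tangent_dir A a u"
    unfolding tangent_dir_def
  proof (intro conjI allI impI)
    show "norm u = 1" using u(1) by simp
    fix \<epsilon> :: real assume "0 < \<epsilon>"
    have "\<forall>\<^sub>F n in sequentially. dist (sgn (p (k n) - a)) u < \<epsilon>"
      using tendstoD[OF u(3) \<open>0 < \<epsilon>\<close>] by simp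
    moreover have "\<forall>\<^sub>F n in sequentially. inverse (real (Suc n)) < \<epsilon>"
      using order_tendstoD(2)[OF LIMSEQ_inverse_real_of_nat \<open>0 < \<epsilon>\<close>] .
    ultimately have "\<forall>\<^sub>F n in sequentially. dist (sgn (p (k n) - a)) u < \<epsilon> \<and> inverse (real (Suc n)) < \<epsilon>"
      by (rule eventually_conj)
    then obtain n where n: "dist (sgn (p (k n) - a)) u < \<epsilon>" "inverse (real (Suc n)) < \<epsilon>"
      using eventually_happens'[OF sequentially_bot] by blast
    have "norm (p (k n) - a) < inverse (real (Suc (k n)))" by (rule p(3))
    also have "\<dots> \<le> inverse (real (Suc n))"
      using seq_suble[OF u(2), of n] by (intro le_imp_inverse_le) auto
    finally show "\<exists>p\<in>A. p \<noteq> a \<and> norm (p - a) < \<epsilon> \<and> norm (sgn (p - a) - u) < \<epsilon>"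
      using n p(1,2) by (intro bexI[of _ "p (k n)"]) (auto simp: dist_norm)
  qed
  ultimately show False using no by blast
qed

text \<open>Normals near the origin make almost a right or an obtuse angle with each tangent
  direction. The exterior ball at \<open>w\<close> is tested against one fixed point
  \<open>p\<close> of \<open>A\<close> in nearly the direction \<open>u\<close>, and
  \<open>z\<close> is then taken much closer to the origin than \<open>p\<close>.\<close>

lemma normals_tangent_dir:
  fixes A :: "'a::real_inner set"
  assumes ext: "exterior_balls R A" and "0 < R" "0 \<in> A" "tangent_dir A 0 u" "0 < \<epsilon>"
  shows "\<exists>\<delta>>0. \<forall>z w. norm z < \<delta> \<longrightarrow> z \<notin> A \<longrightarrow> nearest A z w \<longrightarrow> (z - w) \<bullet> u \<le> \<epsilon> * dist z w"
proof -
  \<comment> \<open>The bound \<open>\<epsilon> / 4\<close> controls the direction error and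
    \<open>\<epsilon> * R / 8\<close> the quadratic term of the exterior ball. Together with the
    shift by \<open>w\<close>, three errors of \<open>\<epsilon> / 4\<close> arise.\<close>
  have "0 < min (\<epsilon> / 4) (\<epsilon> * R / 8)" using assms by simp
  then obtain p where p: "p \<in> A" "p \<noteq> 0" "norm p < min (\<epsilon> / 4) (\<epsilon> * R / 8)"
      "norm (sgn p - u) < min (\<epsilon> / 4) (\<epsilon> * R / 8)"
    using assms(4) unfolding tangent_dir_def by (metis diff_zero)
  define \<rho> where "\<rho> = norm p"
  have "0 < \<rho>" using p by (simp add: \<rho>_def)
  define \<delta> where "\<delta> = min R (\<rho> / 2 * min 1 (\<epsilon> / 4))"
  have "0 < \<delta>" using assms \<open>0 < \<rho>\<close> by (simp add: \<delta>_def)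
  have \<delta>: "\<delta> \<le> R" "2 * \<delta> \<le> \<rho>" "2 * \<delta> \<le> \<rho> * (\<epsilon> / 4)"
  proof -
    show "\<delta> \<le> R" by (simp add: \<delta>_def)
    have "2 * \<delta> \<le> \<rho> * min 1 (\<epsilon> / 4)" by (simp add: \<delta>_def)
    moreover have "\<rho> * min 1 (\<epsilon> / 4) \<le> \<rho> * 1" "\<rho> * min 1 (\<epsilon> / 4) \<le> \<rho> * (\<epsilon> / 4)"
      using \<open>0 < \<rho>\<close> by (intro mult_left_mono; simp)+
    ultimately show "2 * \<delta> \<le> \<rho>" "2 * \<delta> \<le> \<rho> * (\<epsilon> / 4)" by linarith+
  qed
  have "(z - w) \<bullet> u \<le> \<epsilon> * dist z w" if z: "norm z < \<delta>" "z \<notin> A" "nearest A z w" for z w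
  proof -
    define d where "d = norm (z - w)"
    have "0 \<le> d" by (simp add: d_def)
    have dz: "d \<le> norm z" using nearest_norm_le[OF z(3) assms(3)] by (simp add: d_def dist_norm)
    have nw: "norm w \<le> 2 * \<delta>"
      using norm_triangle_ineq4[of z "z - w"] dz z(1) by (simp add: d_def)
    have "2 * R * ((z - w) \<bullet> (p - w)) \<le> d * (norm (p - w))\<^sup>2"
      using ext z p(1) dz \<delta>(1) unfolding exterior_balls_def d_def dist_norm by (smt (verit))
    also have "\<dots> \<le> d * (2 * \<rho>)\<^sup>2"
      using norm_triangle_ineq4[of p w] nw \<delta>(2) \<open>0 \<le> d\<close>
      by (intro mult_left_mono power_mono) (auto simp: \<rho>_def)
    also have "\<dots> \<le> d * (4 * \<rho> * (\<epsilon> * R / 8))"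
      using p(3) \<open>0 \<le> d\<close> \<open>0 < \<rho>\<close> unfolding power2_eq_square
      by (intro mult_left_mono) (auto simp: \<rho>_def mult.commute)
    finally have "R * ((z - w) \<bullet> (p - w)) \<le> R * (d * \<rho> * (\<epsilon> / 4))" by (simp add: algebra_simps)
    then have 1: "(z - w) \<bullet> (p - w) \<le> d * \<rho> * (\<epsilon> / 4)" using assms(2) by simp
    have "(z - w) \<bullet> w \<le> d * norm w" unfolding d_def by (rule norm_cauchy_schwarz)
    also have "\<dots> \<le> d * (\<rho> * (\<epsilon> / 4))" using nw \<delta>(3) \<open>0 \<le> d\<close> by (intro mult_left_mono) auto
    finally have "(z - w) \<bullet> p \<le> \<rho> * (d * (\<epsilon> / 2))"
      using 1 by (simp add: inner_diff_right algebra_simps)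
    then have "inverse \<rho> * ((z - w) \<bullet> p) \<le> d * (\<epsilon> / 2)"
      using \<open>0 < \<rho>\<close> by (simp add: field_simps)
    then have "(z - w) \<bullet> sgn p \<le> d * (\<epsilon> / 2)" unfolding sgn_div_norm inner_scaleR_right \<rho>_def .
    moreover have "(z - w) \<bullet> (u - sgn p) \<le> d * (\<epsilon> / 4)"
    proof -
      have "(z - w) \<bullet> (u - sgn p) \<le> d * norm (u - sgn p)" unfolding d_def by (rule norm_cauchy_schwarz)
      also have "\<dots> \<le> d * (\<epsilon> / 4)"
        using p(4) \<open>0 \<le> d\<close> by (intro mult_left_mono) (auto simp: norm_minus_commute)
      finally show ?thesis .
    qed
    ultimately have "(z - w) \<bullet> u \<le> d * (\<epsilon> / 2) + d * (\<epsilon> / 4)"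
      unfolding inner_diff_right[of "z - w" u] by linarith
    also have "\<dots> \<le> \<epsilon> * d" using \<open>0 \<le> d\<close> assms(5) by (simp add: field_simps)
    finally show ?thesis by (simp add: d_def dist_norm)
  qed
  then show ?thesis using \<open>0 < \<delta>\<close> by blast
qed

section \<open>The three tangent configurations\<close>

lemma dist_le_abs_diffs: "dist z w \<le> \<bar>fst z - fst w\<bar> + \<bar>snd z - snd w\<bar>" for z w :: "real \<times> real"
  using norm_Pair_le[of "fst (z - w)" "snd (z - w)"] unfolding prod.collapse by (simp add: dist_norm)

text \<open>A normal almost non-acute to both \<open>(h, - k)\<close> and \<open>(- h, - k)\<close>
  satisfies \<open>\<bar>x\<bar> * \<bar>h\<bar> \<le> y * k + \<epsilon> * d\<close>. A small
  vertical part would therefore force a small horizontal part, so the normal must point upwards with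
  a definite slope.\<close>

lemma two_tangents_imp_T1:
  assumes "closed A" "0 \<in> A" "0 \<notin> interior A" and ext: "exterior_balls R A" and "0 < R"
    and tan: "tangent_dir A 0 (h, - k)" "tangent_dir A 0 (- h, - k)" and hk: "h \<noteq> 0" "0 < k"
  shows "\<exists>r>0. T1_tilde r (A \<inter> ball 0 r)"
proof -
  have "norm (h, - k) = 1" using tan(1) by (simp add: tangent_dir_def)
  then have hk1: "\<bar>h\<bar> \<le> 1" "k \<le> 1" using abs_fst_le[of "(h, -k)"] abs_snd_le[of "(h, -k)"] by auto
  define c where "c = \<bar>h\<bar> / 4"
  \<comment> \<open>The factor \<open>k\<close> can be cancelled to bound \<open>y\<close> from
    below by \<open>- (\<bar>h\<bar> * d / 4)\<close>; since \<open>k \<le> 1\<close>, also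
    \<open>\<epsilon> * d \<le> \<bar>h\<bar> * d / 4\<close>.\<close>
  define \<epsilon> where "\<epsilon> = \<bar>h\<bar> * k / 4"
  have c: "0 < c" "c \<le> 1" using hk hk1 by (auto simp: c_def)
  have "0 < \<epsilon>" using hk by (simp add: \<epsilon>_def)
  obtain \<delta>1 \<delta>2 where \<delta>: "0 < \<delta>1" "0 < \<delta>2"
    "\<And>z w. norm z < \<delta>1 \<Longrightarrow> z \<notin> A \<Longrightarrow> nearest A z w \<Longrightarrow> (z - w) \<bullet> (h, - k) \<le> \<epsilon> * dist z w"
    "\<And>z w. norm z < \<delta>2 \<Longrightarrow> z \<notin> A \<Longrightarrow> nearest A z w \<Longrightarrow> (z - w) \<bullet> (- h, - k) \<le> \<epsilon> * dist z w"
    using normals_tangent_dir[OF ext assms(5,2) tan(1) \<open>0 < \<epsilon>\<close>]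
      normals_tangent_dir[OF ext assms(5,2) tan(2) \<open>0 < \<epsilon>\<close>] by blast
  show ?thesis
  proof (rule vertical_normals_imp_T1[OF assms(1-3) ext assms(5) c, of "min \<delta>1 \<delta>2"])
    show "0 < min \<delta>1 \<delta>2" using \<delta> by simp
    fix z w assume z: "norm z < min \<delta>1 \<delta>2" "z \<notin> A" "nearest A z w"
    define d where "d = dist z w"
    define x where "x = fst z - fst w"
    define y where "y = snd z - snd w"
    have 1: "x * h - y * k \<le> \<epsilon> * d" "- (x * h) - y * k \<le> \<epsilon> * d"
      using \<delta>(3)[of z w] \<delta>(4)[of z w] z by (simp_all add: inner_prod_def x_def y_def d_def)
    have "0 \<le> d" by (simp add: d_def)
    have "\<bar>x\<bar> * \<bar>h\<bar> \<le> y * k + \<epsilon> * d"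
      using 1 by (auto simp: abs_mult[symmetric] abs_le_iff)
    moreover have "d \<le> \<bar>x\<bar> + \<bar>y\<bar>"
      using dist_le_abs_diffs[of z w] by (simp add: d_def x_def y_def)
    then have "\<bar>h\<bar> * d \<le> \<bar>h\<bar> * (\<bar>x\<bar> + \<bar>y\<bar>)" by (intro mult_left_mono) auto
    ultimately have 2: "\<bar>h\<bar> * d \<le> y * k + \<epsilon> * d + \<bar>h\<bar> * \<bar>y\<bar>" by (simp add: algebra_simps)
    have ed: "\<epsilon> * d \<le> \<bar>h\<bar> * d / 4"
    proof -
      have "\<bar>h\<bar> * d * k \<le> \<bar>h\<bar> * d * 1" using hk1 \<open>0 \<le> d\<close> by (intro mult_left_mono) auto
      then show ?thesis by (simp add: \<epsilon>_def mult_ac)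
    qed
    have "0 \<le> y * k + \<epsilon> * d" using \<open>\<bar>x\<bar> * \<bar>h\<bar> \<le> _\<close> by (smt (verit) abs_ge_zero mult_nonneg_nonneg)
    then have "0 \<le> k * (y + \<bar>h\<bar> * d / 4)" by (simp add: \<epsilon>_def algebra_simps)
    then have y1: "- (\<bar>h\<bar> * d / 4) \<le> y" using hk(2) by (simp add: zero_le_mult_iff)
    have "\<bar>h\<bar> * d / 4 \<le> y"
    proof (cases "0 \<le> y")
      case True
      then have "y * k \<le> y" "\<bar>h\<bar> * \<bar>y\<bar> \<le> y"
        using hk1 hk(2) by (simp_all add: mult_left_le mult_left_le_one_le)
      then show ?thesis using 2 ed True by linarith
    next
      case False
      then have "y * k \<le> 0" "\<bar>h\<bar> * \<bar>y\<bar> \<le> - y"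
        using hk1 hk(2) by (simp_all add: mult_left_le_one_le mult_nonpos_nonneg)
      \<comment> \<open>A negative \<open>y\<close> forces \<open>d = 0\<close>, and
        \<open>y1\<close> then contradicts the sign of \<open>y\<close>.\<close>
      then have "\<bar>h\<bar> * d \<le> 0" using 2 ed y1 by linarith
      then show ?thesis using 2 ed y1 hk \<open>y * k \<le> 0\<close> False \<open>0 \<le> d\<close> by (simp add: mult_le_0_iff)
    qed
    then show "c * dist z w \<le> snd z - snd w" by (simp add: c_def d_def y_def)
  qed
qed

text \<open>The closed double cone \<open>?K\<close> about the vertical axis meets the horizontal
  axis only in 0, so it contains no tangent direction and secants eventually avoid it. The condition
  is homogeneous and passes from \<open>sgn p\<close> to \<open>p\<close>.\<close>

lemma horizontal_tangents_imp_flat: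
  assumes "\<And>u. tangent_dir A 0 u \<Longrightarrow> snd u = 0"
  shows "flat_at_zero A"
  unfolding flat_at_zero_def
proof (intro allI impI)
  fix \<epsilon> :: real assume "0 < \<epsilon>"
  let ?K = "{u :: real \<times> real. \<epsilon> * \<bar>fst u\<bar> \<le> \<bar>snd u\<bar>}"
  have "\<exists>\<eta>>0. \<forall>p\<in>A. p \<noteq> 0 \<longrightarrow> norm (p - 0) < \<eta> \<longrightarrow> sgn (p - 0) \<notin> ?K"
  proof (rule tangent_dir_avoids_closed)
    show "closed ?K" by (intro closed_Collect_le continuous_intros)
    fix u assume u: "u \<in> ?K"
    show "\<not> tangent_dir A 0 u"
    proof
      assume t: "tangent_dir A 0 u"
      then have "snd u = 0" by (rule assms)
      then have "u = 0" using u \<open>0 < \<epsilon>\<close> by (cases u) (simp add: mult_le_0_iff zero_prod_def)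
      then show False using t by (simp add: tangent_dir_def)
    qed
  qed
  then obtain \<eta> where \<eta>: "0 < \<eta>" "\<And>p. p \<in> A \<Longrightarrow> p \<noteq> 0 \<Longrightarrow> norm p < \<eta> \<Longrightarrow> sgn p \<notin> ?K" by auto
  have "\<bar>snd p\<bar> \<le> \<epsilon> * \<bar>fst p\<bar>" if p: "p \<in> A" "norm p < \<eta>" for p
  proof (cases "p = 0")
    case False
    then have "\<bar>snd (sgn p)\<bar> < \<epsilon> * \<bar>fst (sgn p)\<bar>" using \<eta>(2)[of p] p by auto
    then have "inverse (norm p) * \<bar>snd p\<bar> < inverse (norm p) * (\<epsilon> * \<bar>fst p\<bar>)"
      by (simp add: sgn_div_norm abs_mult mult_ac)
    then show ?thesis using False by (simp add: mult_less_cancel_left_pos)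
  qed simp
  then show "\<exists>\<eta>>0. \<forall>p\<in>A. norm p < \<eta> \<longrightarrow> \<bar>snd p\<bar> \<le> \<epsilon> * \<bar>fst p\<bar>" using \<eta>(1) by blast
qed

text \<open>The two opposite tangents bound the horizontal part of a normal by half its length from
  both sides, leaving at least half for the vertical part.\<close>

lemma line_tangent_imp_T2:
  assumes "closed A" "0 \<in> A" and ext: "exterior_balls R A" and "0 < R"
    and tan: "tangent_dir A 0 (1, 0)" "tangent_dir A 0 (-1, 0)"
    and only: "\<And>u. tangent_dir A 0 u \<Longrightarrow> snd u = 0"
  shows "\<exists>r>0. T2_tilde r (A \<inter> ball 0 r)"
proof -
  obtain \<delta>1 \<delta>2 :: real where \<delta>: "0 < \<delta>1" "0 < \<delta>2"
    "\<And>z w. norm z < \<delta>1 \<Longrightarrow> z \<notin> A \<Longrightarrow> nearest A z w \<Longrightarrow> (z - w) \<bullet> (1, 0) \<le> 1 / 2 * dist z w"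
    "\<And>z w. norm z < \<delta>2 \<Longrightarrow> z \<notin> A \<Longrightarrow> nearest A z w \<Longrightarrow> (z - w) \<bullet> (-1, 0) \<le> 1 / 2 * dist z w"
    using normals_tangent_dir[OF ext assms(4,2) tan(1), of "1/2"]
      normals_tangent_dir[OF ext assms(4,2) tan(2), of "1/2"] by auto
  have steep: "1 / 2 * dist z w \<le> \<bar>snd z - snd w\<bar>"
    if "norm z < min \<delta>1 \<delta>2" "z \<notin> A" "fst z \<in> UNIV" "nearest A z w" for z w
  proof -
    have "fst z - fst w \<le> dist z w / 2" "fst w - fst z \<le> dist z w / 2"
      using \<delta>(3)[of z w] \<delta>(4)[of z w] that by (simp_all add: inner_prod_def)
    then show ?thesis using dist_le_abs_diffs[of z w] by linarith
  qed
  obtain r \<phi> \<psi> where *: "0 < r" "is_lipschitz_on (UNIV \<inter> {-r<..<r}) \<phi>" "is_lipschitz_on (UNIV \<inter> {-r<..<r}) \<psi>"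
    "\<forall>x\<in>UNIV \<inter> {-r<..<r}. \<psi> x \<le> \<phi> x"
    "\<And>C. convex C \<Longrightarrow> C \<subseteq> UNIV \<inter> {-r<..<r} \<Longrightarrow> semiconcave_on C \<phi>"
    "\<And>C. convex C \<Longrightarrow> C \<subseteq> UNIV \<inter> {-r<..<r} \<Longrightarrow> semiconvex_on C \<psi>"
    "\<phi> 0 = 0" "\<psi> 0 = 0" "(\<phi> has_real_derivative 0) (at 0)"
    "(\<psi> has_real_derivative 0) (at 0)"
    "A \<inter> ball 0 r = ball 0 r \<inter> hypo (UNIV \<inter> {-r<..<r}) \<phi> \<inter> epi (UNIV \<inter> {-r<..<r}) \<psi>"
    by (rule flat_at_zero_graphs[of A R UNIV "min \<delta>1 \<delta>2", OF assms(1,2) ext assms(4) _ _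
          horizontal_tangents_imp_flat[OF only] steep]) (use \<delta> in auto)
  have "semiconcave_on {-r<..<r} \<phi>" "semiconvex_on {-r<..<r} \<psi>"
    using *(5,6)[of "{-r<..<r}"] by (auto simp: convex_real_interval)
  then show ?thesis
    using * unfolding T2_tilde_def Int_UNIV_left by blast
qed

text \<open>The tangent \<open>(1, 0)\<close> only limits how far normals point to the right. For
  the left, the origin itself serves as test point of the exterior ball at \<open>w\<close>, and if
  \<open>w\<close> is the origin the restriction to \<open>fst z \<ge> 0\<close> suffices.\<close>

lemma ray_tangent_imp_T3:
  assumes "closed A" "0 \<in> A" and ext: "exterior_balls R A" and "0 < R"
    and tan: "tangent_dir A 0 (1, 0)" and only: "\<And>u. tangent_dir A 0 u \<Longrightarrow> u = (1, 0)"
  shows "\<exists>r>0. T3_tilde r (A \<inter> ball 0 r)"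
proof -
  have flat: "flat_at_zero A" by (rule horizontal_tangents_imp_flat) (auto dest: only)
  obtain \<delta>1 :: real where \<delta>1: "0 < \<delta>1"
    "\<And>z w. norm z < \<delta>1 \<Longrightarrow> z \<notin> A \<Longrightarrow> nearest A z w \<Longrightarrow> (z - w) \<bullet> (1, 0) \<le> 1 / 2 * dist z w"
    using normals_tangent_dir[OF ext assms(4,2) tan, of "1/2"] by auto
  obtain \<delta>2 where \<delta>2: "0 < \<delta>2" "\<And>p. p \<in> A \<Longrightarrow> norm p < \<delta>2 \<Longrightarrow> \<bar>snd p\<bar> \<le> 1 / 8 * \<bar>fst p\<bar>"
    using flat unfolding flat_at_zero_def by (metis zero_less_divide_1_iff zero_less_numeral)
  have "\<exists>\<eta>>0. \<forall>p\<in>A. p \<noteq> 0 \<longrightarrow> norm (p - 0) < \<eta> \<longrightarrow> sgn (p - 0) \<notin> {u. fst u \<le> 0}"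
    by (rule tangent_dir_avoids_closed)
      (auto intro!: closed_Collect_le continuous_intros dest: only)
  then obtain \<delta>3 where \<delta>3: "0 < \<delta>3" "\<And>p. p \<in> A \<Longrightarrow> p \<noteq> 0 \<Longrightarrow> norm p < \<delta>3 \<Longrightarrow> 0 < fst p"
    by (auto simp: sgn_div_norm not_le zero_less_mult_iff)
  \<comment> \<open>The nearest point satisfies \<open>norm w < 2 * \<delta>\<close>; the halves
    bring it into the ranges of \<open>\<delta>2\<close> and \<open>\<delta>3\<close>, and
    \<open>R / 16\<close> gives \<open>fst w \<le> R / 8\<close>.\<close>
  define \<delta> where "\<delta> = min (min \<delta>1 (R / 16)) (min (\<delta>2 / 2) (\<delta>3 / 2))"
  have "0 < \<delta>" using \<delta>1(1) \<delta>2(1) \<delta>3(1) assms(4) by (simp add: \<delta>_def)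
  have steep: "1 / 2 * dist z w \<le> \<bar>snd z - snd w\<bar>"
    if z: "norm z < \<delta>" "z \<notin> A" "fst z \<in> {0..}" "nearest A z w" for z w
  proof -
    define d where "d = norm (z - w)"
    have "0 \<le> d" by (simp add: d_def)
    have dz: "d \<le> norm z" using nearest_norm_le[OF z(4) assms(2)] by (simp add: d_def dist_norm)
    have nw: "norm w < 2 * \<delta>"
      using norm_triangle_ineq4[of z "z - w"] dz z(1) by (simp add: d_def)
    have "w \<in> A" using z(4) by (simp add: nearest_def)
    have up: "fst z - fst w \<le> d / 2"
      using \<delta>1(2)[OF _ z(2,4)] z(1) by (simp add: \<delta>_def inner_prod_def d_def dist_norm)
    have low: "- (d / 2) \<le> fst z - fst w"
    proof (cases "w = 0")
      case True
      then show ?thesis using z(3) \<open>0 \<le> d\<close> by simp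
    next
      case False
      have w1: "0 < fst w" using \<delta>3(2)[OF \<open>w \<in> A\<close> False] nw by (simp add: \<delta>_def)
      have w2: "\<bar>snd w\<bar> \<le> fst w / 8" using \<delta>2(2)[OF \<open>w \<in> A\<close>] nw w1 by (simp add: \<delta>_def)
      have nw2: "norm w \<le> 2 * fst w"
        using norm_Pair_le[of "fst w" "snd w"] w1 w2 unfolding prod.collapse by linarith
      have "d < R" using dz z(1) assms(4) by (simp add: \<delta>_def)
      then have "2 * R * ((z - w) \<bullet> (0 - w)) \<le> d * (norm (0 - w))\<^sup>2"
        using ext z assms(2) unfolding exterior_balls_def d_def dist_norm by blast
      also have "\<dots> \<le> d * (2 * fst w)\<^sup>2"
        using nw2 \<open>0 \<le> d\<close> by (intro mult_left_mono power_mono) auto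
      also have "\<dots> = 4 * (d * (fst w * fst w))" by (simp add: power2_eq_square)
      also have "\<dots> \<le> 4 * (d * (fst w * (R / 8)))"
        using abs_fst_le[of w] nw w1 \<open>0 \<le> d\<close>
        by (intro mult_left_mono) (auto simp: \<delta>_def)
      finally have "R * ((z - w) \<bullet> (0 - w)) \<le> R * (d * fst w / 4)" by (simp add: algebra_simps)
      then have "(z - w) \<bullet> (0 - w) \<le> d * fst w / 4" using assms(4) by (rule mult_left_le_imp_le)
      then have "- (fst z - fst w) * fst w \<le> d * fst w / 4 + (snd z - snd w) * snd w"
        by (simp add: inner_prod_def algebra_simps)
      moreover have "\<bar>(snd z - snd w) * snd w\<bar> \<le> d * (fst w / 8)"
        unfolding abs_mult using abs_snd_le[of "z - w"] w2 \<open>0 \<le> d\<close>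
        by (intro mult_mono) (auto simp: d_def)
      \<comment> \<open>The contributions 1/4 from the exterior ball and 1/8 from flatness add up to
        less than 1/2.\<close>
      ultimately have "- (fst z - fst w) * fst w \<le> d * fst w / 2"
        using mult_nonneg_nonneg[OF \<open>0 \<le> d\<close> less_imp_le[OF w1]] by linarith
      then have "- (fst z - fst w) * fst w \<le> (d / 2) * fst w" by simp
      then have "- (fst z - fst w) \<le> d / 2" using w1 by (rule mult_right_le_imp_le)
      then show ?thesis by simp
    qed
    then show ?thesis using up dist_le_abs_diffs[of z w] unfolding d_def dist_norm by linarith
  qed
  have inD: "fst p \<in> {0..}" if "p \<in> A" "norm p < \<delta>" for p
    using \<delta>3(2)[OF that(1)] that(2) \<delta>3(1) by (cases "p = 0") (auto simp: \<delta>_def)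
  obtain r \<phi> \<psi> where *: "0 < r" "is_lipschitz_on ({0..} \<inter> {-r<..<r}) \<phi>" "is_lipschitz_on ({0..} \<inter> {-r<..<r}) \<psi>"
    "\<forall>x\<in>{0..} \<inter> {-r<..<r}. \<psi> x \<le> \<phi> x"
    "\<And>C. convex C \<Longrightarrow> C \<subseteq> {0..} \<inter> {-r<..<r} \<Longrightarrow> semiconcave_on C \<phi>"
    "\<And>C. convex C \<Longrightarrow> C \<subseteq> {0..} \<inter> {-r<..<r} \<Longrightarrow> semiconvex_on C \<psi>"
    "\<phi> 0 = 0" "\<psi> 0 = 0" "(\<phi> has_real_derivative 0) (at 0 within {0..})"
    "(\<psi> has_real_derivative 0) (at 0 within {0..})"
    "A \<inter> ball 0 r = ball 0 r \<inter> hypo ({0..} \<inter> {-r<..<r}) \<phi> \<inter> epi ({0..} \<inter> {-r<..<r}) \<psi>"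
    by (rule flat_at_zero_graphs[of A R "{0..}" \<delta>, OF assms(1,2) ext assms(4) _ \<open>0 < \<delta>\<close> flat steep inD]) auto
  have D: "{0..} \<inter> {-r<..<r} = {0..<r}" using *(1) by auto
  have "semiconcave_on {0<..<r} \<phi>" "semiconvex_on {0<..<r} \<psi>"
    by (rule *(5) *(6); use *(1) in \<open>auto simp: convex_real_interval\<close>)+
  then show ?thesis
    using * unfolding T3_tilde_def D at_within_Ici_at_right by blast
qed

section \<open>Rigid motions\<close>

text \<open>These are the coordinates with respect to the orthonormal basis formed by
  \<open>e\<close> and its quarter turn.\<close>

lemma orthogonal_frame:
  fixes e :: "real \<times> real"
  assumes "norm e = 1"
  shows "orthogonal_transformation (\<lambda>v. (v \<bullet> e, v \<bullet> (- snd e, fst e)))"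
  unfolding orthogonal_transformation_def
proof (intro conjI allI)
  show "linear (\<lambda>v. (v \<bullet> e, v \<bullet> (- snd e, fst e)))"
    by (rule linearI) (simp_all add: inner_add_left)
  fix v w :: "real \<times> real"
  have 1: "fst e * fst e + snd e * snd e = 1"
    using assms power2_norm_eq_inner[of e] by (simp add: inner_prod_def)
  have "(v \<bullet> e, v \<bullet> (- snd e, fst e)) \<bullet> (w \<bullet> e, w \<bullet> (- snd e, fst e))
      = (v \<bullet> w) * (fst e * fst e + snd e * snd e)"
    by (simp add: inner_prod_def algebra_simps)
  then show "(v \<bullet> e, v \<bullet> (- snd e, fst e)) \<bullet> (w \<bullet> e, w \<bullet> (- snd e, fst e)) = v \<bullet> w"
    using 1 by simp
qed

locale rigid_motion =
  fixes f :: "'a::euclidean_space \<Rightarrow> 'a" and a :: 'a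
  assumes orthogonal_f: "orthogonal_transformation f"
begin

definition G :: "'a \<Rightarrow> 'a" where "G x = f (x - a)"

lemma linear_f: "linear f"
  using orthogonal_f by (simp add: orthogonal_transformation_def)

lemma norm_f: "norm (f x) = norm x"
  using orthogonal_f by (simp add: orthogonal_transformation_norm)

lemma G_diff: "G x - G y = f (x - y)"
  using linear_diff[OF linear_f, of "x - a" "y - a"] by (simp add: G_def)

lemma dist_G: "dist (G x) (G y) = dist x y"
  by (simp add: dist_norm G_diff norm_f)

lemma isometry_G: "isometry G"
  by (simp add: isometry_def dist_G)

lemma G_eq_iff: "G x = G y \<longleftrightarrow> x = y"
  using dist_G[of x y] by (metis dist_eq_0_iff)

lemma G_center: "G a = 0"
  by (simp add: G_def linear_0[OF linear_f])

lemma norm_G: "norm (G x) = norm (x - a)"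
  by (simp add: G_def norm_f)

lemma obtain_preimage: obtains x where "y = G x"
proof -
  obtain v where "y = f v" using orthogonal_transformation_surj[OF orthogonal_f] by (metis surjD)
  then show thesis using that[of "v + a"] by (simp add: G_def)
qed

lemma nearest_G:
  assumes "nearest (G ` A) (G z) (G w)"
  shows "nearest A z w"
proof (rule nearestI)
  show "w \<in> A" using assms G_eq_iff by (auto simp: nearest_def)
  show "dist z w \<le> dist z q" if "q \<in> A" for q
    using nearest_le[OF assms, of "G q"] that by (simp add: dist_G)
qed

lemma exterior_balls_G:
  assumes "exterior_balls R A"
  shows "exterior_balls R (G ` A)"
  unfolding exterior_balls_def
proof (intro allI impI)
  fix z' w' q' assume z': "z' \<notin> G ` A" "nearest (G ` A) z' w'" "dist z' w' < R" "q' \<in> G ` A"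
  obtain z where z: "z' = G z" by (rule obtain_preimage)
  obtain w where w: "w' = G w" by (rule obtain_preimage)
  obtain q where q: "q' = G q" "q \<in> A" using z'(4) by blast
  have "z \<notin> A" using z'(1) unfolding z by blast
  moreover have "nearest A z w" using z'(2) unfolding z w by (rule nearest_G)
  moreover have "dist z w < R" using z'(3) unfolding z w dist_G .
  ultimately have "2 * R * ((z - w) \<bullet> (q - w)) \<le> norm (z - w) * (norm (q - w))\<^sup>2"
    using assms q(2) unfolding exterior_balls_def by blast
  then show "2 * R * ((z' - w') \<bullet> (q' - w')) \<le> norm (z' - w') * (norm (q' - w'))\<^sup>2"
    using orthogonal_f unfolding z w q(1) G_diff norm_f by (simp add: orthogonal_transformation_def)
qed

lemma tangent_dir_G: "tangent_dir (G ` A) 0 (f u) \<longleftrightarrow> tangent_dir A a u"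
proof -
  have "norm (sgn (G p) - f u) = norm (sgn (p - a) - u)" for p
  proof -
    have "sgn (G p) - f u = f (sgn (p - a) - u)"
      unfolding sgn_div_norm norm_G linear_diff[OF linear_f, of _ u] linear_scale[OF linear_f] G_def norm_f ..
    then show ?thesis by (simp add: norm_f)
  qed
  moreover have "G p = 0 \<longleftrightarrow> p = a" for p using G_eq_iff[of p a] G_center by simp
  ultimately show ?thesis
    unfolding tangent_dir_def by (simp add: norm_G norm_f)
qed

lemma image_Int_ball: "G ` (A \<inter> ball a r) = G ` A \<inter> ball 0 r"
proof -
  have "x \<in> ball a r \<longleftrightarrow> G x \<in> ball 0 r" for x
    using dist_G[of a x] by (simp add: G_center)
  then show ?thesis by blast
qed

lemma closed_image: "compact A \<Longrightarrow> closed (G ` A)"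
proof (intro compact_imp_closed compact_continuous_image)
  have "1-lipschitz_on A G" by (rule lipschitz_onI) (simp_all add: dist_G)
  then show "continuous_on A G" by (rule lipschitz_on_continuous_on)
qed

lemma not_interior_image:
  assumes "a \<notin> interior A"
  shows "0 \<notin> interior (G ` A)"
proof
  assume "0 \<in> interior (G ` A)"
  then obtain e where e: "0 < e" "ball 0 e \<subseteq> G ` A" by (auto simp: mem_interior)
  have "ball a e \<subseteq> A"
  proof
    fix x assume "x \<in> ball a e"
    then have "G x \<in> ball 0 e" by (simp add: norm_G dist_norm norm_minus_commute)
    then obtain y where "y \<in> A" "G x = G y" using e(2) by blast
    then show "x \<in> A" by (simp add: G_eq_iff)
  qed
  then show False using assms e(1) by (auto simp: mem_interior)
qed

end

lemma of_type_T_rigid_motion: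
  assumes "orthogonal_transformation f" "a \<in> A" "0 < r"
    and "T_tilde i r (rigid_motion.G f a ` A \<inter> ball 0 r)"
  shows "of_type_T i A a"
proof -
  interpret rigid_motion f a by (rule rigid_motion.intro[OF assms(1)])
  show ?thesis
    unfolding of_type_T_def
  proof (intro conjI exI)
    show "T_tilde i r (G ` (A \<inter> ball a r))" using assms(4) by (simp add: image_Int_ball)
  qed (use assms(2,3) isometry_G G_center in auto)
qed

section \<open>Classification of the boundary points\<close>

lemma independent_units_frame:
  fixes u v :: "real \<times> real"
  assumes "norm u = 1" "norm v = 1" "u \<noteq> v" "u \<noteq> - v"
  obtains f :: "real \<times> real \<Rightarrow> real \<times> real" and h k
  where "orthogonal_transformation f" "f u = (h, - k)" "f v = (- h, - k)" "h \<noteq> 0" "0 < k"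
proof -
  \<comment> \<open>For unit vectors, \<open>u + v\<close> is orthogonal to \<open>u - v\<close>, so \<open>u\<close> and \<open>v\<close> become mirror images.\<close>
  define e where "e = sgn (u - v)"
  define f :: "real \<times> real \<Rightarrow> real \<times> real" where "f w = (w \<bullet> e, w \<bullet> (- snd e, fst e))" for w
  have e1: "norm e = 1" using assms(3) by (simp add: e_def norm_sgn)
  then have f: "orthogonal_transformation f" unfolding f_def by (rule orthogonal_frame)
  have e: "u - v = norm (u - v) *\<^sub>R e" using assms(3) by (simp add: e_def sgn_div_norm)
  have "(u + v) \<bullet> (u - v) = 0"
    using assms(1,2) by (simp add: inner_add_left inner_diff_right inner_commute[of v u] dot_square_norm)
  then have 1: "v \<bullet> e = - (u \<bullet> e)"
    unfolding e_def sgn_div_norm inner_scaleR_right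
    by (simp add: inner_add_left eq_neg_iff_add_eq_0 flip: distrib_left)
  have "e \<bullet> (- snd e, fst e) = 0" by (simp add: inner_prod_def)
  then have "(u - v) \<bullet> (- snd e, fst e) = 0" by (subst e) simp
  then have 2: "v \<bullet> (- snd e, fst e) = u \<bullet> (- snd e, fst e)" by (simp add: inner_diff_left)
  define h where "h = u \<bullet> e"
  define k where "k = - (u \<bullet> (- snd e, fst e))"
  have fu: "f u = (h, - k)" "f v = (- h, - k)"
    using 1 2 by (simp_all add: f_def h_def k_def)
  have inj: "f x = f y \<Longrightarrow> x = y" for x y
    by (rule injD[OF orthogonal_transformation_inj[OF f]])
  have "h \<noteq> 0" using fu inj[of u v] assms(3) by auto
  have "f (- v) = - f v" using f by (simp add: orthogonal_transformation_def linear_neg)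
  then have "k \<noteq> 0" using fu inj[of u "- v"] assms(4) by auto
  then consider "0 < k" | "0 < - k" by linarith
  then show thesis
  proof cases
    case 1
    then show thesis using that[OF f fu \<open>h \<noteq> 0\<close>] by blast
  next
    case 2
    \<comment> \<open>Composing with the central reflection flips the sign of \<open>k\<close> and
      preserves the mirror symmetry of the two images.\<close>
    have "orthogonal_transformation (\<lambda>x. - f x)" using f by (simp add: orthogonal_transformation_neg)
    then show thesis using that[of "\<lambda>x. - f x" "- h" "- k"] fu \<open>h \<noteq> 0\<close> 2 by simp
  qed
qed

text \<open>A non-isolated point has a tangent direction \<open>u\<close>. A further one other than
  \<open>- u\<close> gives type 1; otherwise all directions lie on the line of \<open>u\<close>, and
  the presence or absence of \<open>- u\<close> decides between types 2 and 3.\<close>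

lemma exterior_balls_imp_of_type_T:
  fixes A :: "(real \<times> real) set"
  assumes "compact A" and ext: "exterior_balls R A" and "0 < R" and a: "a \<in> frontier A - isolated_pts A"
  shows "\<exists>i\<in>{1, 2, 3}. of_type_T i A a"
proof -
  have "a \<in> A" "a \<notin> interior A"
    using a frontier_subset_closed[OF compact_imp_closed[OF assms(1)]] by (auto simp: frontier_def)
  have "\<exists>u. tangent_dir A a u"
  proof (rule ccontr)
    assume "\<nexists>u. tangent_dir A a u"
    then obtain \<eta> where "0 < \<eta>" "\<forall>p\<in>A. p \<noteq> a \<longrightarrow> norm (p - a) < \<eta> \<longrightarrow> sgn (p - a) \<notin> UNIV"
      \<comment> \<open>With the whole space as closed set, the lemma says that no other point of
        \<open>A\<close> is close to \<open>a\<close>.\<close>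
      using tangent_dir_avoids_closed[OF closed_UNIV, of A a] by blast
    then have "a isolated_in A"
      using \<open>a \<in> A\<close> unfolding isolated_in_dist_Ex_iff by (metis UNIV_I dist_commute dist_norm)
    then show False using a by (simp add: isolated_pts_def)
  qed
  then obtain u where u: "tangent_dir A a u" by blast
  then have "norm u = 1" by (simp add: tangent_dir_def)
  show ?thesis
  proof (cases "\<exists>v. tangent_dir A a v \<and> v \<noteq> u \<and> u \<noteq> - v")
    case True
    then obtain v where v: "tangent_dir A a v" "v \<noteq> u" "u \<noteq> - v" by blast
    then have "norm v = 1" by (simp add: tangent_dir_def)
    then obtain f :: "real \<times> real \<Rightarrow> real \<times> real" and h k where f: "orthogonal_transformation f" "f u = (h, - k)" "f v = (- h, - k)" "h \<noteq> 0" "0 < k"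
      using independent_units_frame[OF \<open>norm u = 1\<close>, of v] v(2,3) by blast
    interpret rigid_motion f a by (rule rigid_motion.intro[OF f(1)])
    have "0 \<in> G ` A" using \<open>a \<in> A\<close> G_center by (metis imageI)
    moreover have "tangent_dir (G ` A) 0 (h, - k)" "tangent_dir (G ` A) 0 (- h, - k)"
      using tangent_dir_G[of A u] tangent_dir_G[of A v] u v(1) f(2,3) by simp_all
    ultimately obtain r where "0 < r" "T1_tilde r (G ` A \<inter> ball 0 r)"
      using two_tangents_imp_T1[OF closed_image[OF assms(1)] _ not_interior_image[OF \<open>a \<notin> interior A\<close>]
          exterior_balls_G[OF ext] assms(3) _ _ f(4,5)] by blast
    then have "of_type_T 1 A a"
      using of_type_T_rigid_motion[OF f(1) \<open>a \<in> A\<close>, of r 1] by (simp add: T_tilde_def)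
    then show ?thesis by blast
  next
    case False
    define f :: "real \<times> real \<Rightarrow> real \<times> real" where "f w = (w \<bullet> u, w \<bullet> (- snd u, fst u))" for w
    have f: "orthogonal_transformation f" unfolding f_def by (rule orthogonal_frame[OF \<open>norm u = 1\<close>])
    have fu: "f u = (1, 0)"
      using \<open>norm u = 1\<close> power2_norm_eq_inner[of u] by (simp add: f_def inner_prod_def)
    have fmu: "f (- u) = (-1, 0)" using fu by (simp add: f_def)
    interpret rigid_motion f a by (rule rigid_motion.intro[OF f])
    have 0: "0 \<in> G ` A" using \<open>a \<in> A\<close> G_center by (metis imageI)
    have t1: "tangent_dir (G ` A) 0 (1, 0)" using tangent_dir_G[of A u] u fu by simp
    have only: "\<exists>v. w = f v \<and> tangent_dir A a v \<and> (v = u \<or> v = - u)" if "tangent_dir (G ` A) 0 w" for w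
    proof -
      obtain v where v: "w = f v" using orthogonal_transformation_surj[OF f] by (metis surjD)
      then have "tangent_dir A a v" using that tangent_dir_G by simp
      then show ?thesis using v False by (metis minus_minus)
    qed
    show ?thesis
    proof (cases "tangent_dir A a (- u)")
      case True
      then have "tangent_dir (G ` A) 0 (-1, 0)" using tangent_dir_G[of A "- u"] fmu by simp
      moreover have "snd w = 0" if "tangent_dir (G ` A) 0 w" for w
        using only[OF that] fu fmu by auto
      ultimately obtain r where "0 < r" "T2_tilde r (G ` A \<inter> ball 0 r)"
        using line_tangent_imp_T2[OF closed_image[OF assms(1)] 0 exterior_balls_G[OF ext] assms(3) t1] by blast
      then have "of_type_T 2 A a"
        using of_type_T_rigid_motion[OF f \<open>a \<in> A\<close>, of r 2] by (simp add: T_tilde_def)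
      then show ?thesis by blast
    next
      case False
      then have "w = (1, 0)" if "tangent_dir (G ` A) 0 w" for w
        using only[OF that] fu by auto
      then obtain r where "0 < r" "T3_tilde r (G ` A \<inter> ball 0 r)"
        using ray_tangent_imp_T3[OF closed_image[OF assms(1)] 0 exterior_balls_G[OF ext] assms(3) t1] by blast
      then have "of_type_T 3 A a"
        using of_type_T_rigid_motion[OF f \<open>a \<in> A\<close>, of r 3] by (simp add: T_tilde_def)
      then show ?thesis by blast
    qed
  qed
qed

theorem corollary6p5:
  fixes A :: "(real \<times> real) set"
  assumes "compact A" and "A \<noteq> {}"
  shows "positive_reach A \<longleftrightarrow>
    (\<forall>a \<in> frontier A - isolated_pts A. \<exists>i\<in>{1, 2, 3}. of_type_T i A a)"
proof
  assume "positive_reach A"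
  then obtain R where R: "0 < R" "\<And>a. a \<in> A \<Longrightarrow> ball a R \<subseteq> Unp A"
    using positive_reach_iff_uniform[OF assms(2)] by blast
  show "\<forall>a \<in> frontier A - isolated_pts A. \<exists>i\<in>{1, 2, 3}. of_type_T i A a"
    using exterior_balls_imp_of_type_T[OF assms(1) reach_imp_exterior_balls[OF assms(1) R(2)]] R(1)
    by simp
next
  assume "\<forall>a \<in> frontier A - isolated_pts A. \<exists>i\<in>{1, 2, 3}. of_type_T i A a"
  then show "positive_reach A"
    using types_imp_positive_reach[OF assms] by blast
qed

end
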